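(* For every object $(\mathbf{B},\mathbf{D},\phi)$ of the category $\mathfrak{T}$ there is a Stonean residuated lattice $\mathbf{A}$ such that $(\mathbf{B}(\mathbf{A}),\mathbf{D}(\mathbf{A}),\phi_{\mathbf{A}})$ is isomorphic to $(\mathbf{B},\mathbf{D},\phi)$ in $\mathfrak{T}$.
   Context: A residuated lattice is an algebra $(A,\ast,\to,\vee,\wedge,\top)$ such that $(A,\ast,\top)$ is a commutative monoid, $(A,\vee,\wedge)$ is a lattice with greatest element $\top$, and $x\ast y\le z$ iff $x\le y\to z$. A bounded residuated lattice additionally has a constant $\bot$ that is the least element; $\neg x:=x\to\bot$. An element $x$ is dense if $\neg x=\bot$; the dense elements form a residuated lattice $\mathbf{D}(\mathbf{A})$. An element $x$ is Boolean if $x\vee\neg x=\top$ and $x\wedge\neg x=\bot$; the Boolean elements form a Boolean algebra $\mathbf{B}(\mathbf{A})$. A Stonean residuated lattice is a bounded residuated lattice satisfying $\neg x\vee\neg\neg x=\top$. An i-filter of a residuated lattice $\mathbf{D}$ is a subset $F$ with $\top\in F$ such that $x,x\to y\in F$ imply $y\in F$; $\mathcal{F}_i(\mathbf{D})$ is the bounded lattice of i-filters under inclusion. For Stonean $\mathbf{A}$ and $a\in B(\mathbf{A})$, $\phi_{\mathbf{A}}(a)=\{x\in D(\mathbf{A}):x\ge\neg a\}$. The category $\mathfrak{T}$: objects are triples $(\mathbf{B},\mathbf{D},\phi)$ with $\mathbf{B}$ a Boolean algebra, $\mathbf{D}$ a residuated lattice, $\phi:\mathbf{B}\to\mathcal{F}_i(\mathbf{D})$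 a lattice homomorphism preserving bottom and top; morphisms $(\mathbf{B}_1,\mathbf{D}_1,\phi_1)\to(\mathbf{B}_2,\mathbf{D}_2,\phi_2)$ are pairs $(h,k)$ of a Boolean homomorphism $h:\mathbf{B}_1\to\mathbf{B}_2$ and a residuated lattice homomorphism $k:\mathbf{D}_1\to\mathbf{D}_2$ with $k(\phi_1(a))\subseteq\phi_2(h(a))$ for all $a\in B_1$. *)

theory Defs
  imports "HOL-Algebra.Group"
begin

text \<open>
  Lattices are taken as algebras with two operations on an explicit carrier; the lattices of
  \<^theory>\<open>HOL-Algebra.Lattice\<close> are order structures whose joins and meets are not part of the
  signature, so they do not provide the subalgebras and homomorphisms used here.
\<close>

record 'a lattice_alg = "'a partial_object" +
  join_op :: "'a \<Rightarrow> 'a \<Rightarrow> 'a"  (infixl "\<curlyvee>\<index>" 65)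
  meet_op :: "'a \<Rightarrow> 'a \<Rightarrow> 'a"  (infixl "\<curlywedge>\<index>" 70)

definition lattice_le :: "('a, 'm) lattice_alg_scheme \<Rightarrow> 'a \<Rightarrow> 'a \<Rightarrow> bool"  (infix "\<preceq>\<index>" 50)
  where "x \<preceq>\<^bsub>L\<^esub> y \<longleftrightarrow> x \<curlywedge>\<^bsub>L\<^esub> y = x"

locale alg_lattice =
  fixes L (structure)
  assumes join_closed: "\<lbrakk>x \<in> carrier L; y \<in> carrier L\<rbrakk> \<Longrightarrow> x \<curlyvee> y \<in> carrier L"
    and meet_closed: "\<lbrakk>x \<in> carrier L; y \<in> carrier L\<rbrakk> \<Longrightarrow> x \<curlywedge> y \<in> carrier L"
    and join_comm: "\<lbrakk>x \<in> carrier L; y \<in> carrier L\<rbrakk> \<Longrightarrow> x \<curlyvee> y = y \<curlyvee> x"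
    and meet_comm: "\<lbrakk>x \<in> carrier L; y \<in> carrier L\<rbrakk> \<Longrightarrow> x \<curlywedge> y = y \<curlywedge> x"
    and join_assoc: "\<lbrakk>x \<in> carrier L; y \<in> carrier L; z \<in> carrier L\<rbrakk>
                      \<Longrightarrow> (x \<curlyvee> y) \<curlyvee> z = x \<curlyvee> (y \<curlyvee> z)"
    and meet_assoc: "\<lbrakk>x \<in> carrier L; y \<in> carrier L; z \<in> carrier L\<rbrakk>
                      \<Longrightarrow> (x \<curlywedge> y) \<curlywedge> z = x \<curlywedge> (y \<curlywedge> z)"
    and join_absorb: "\<lbrakk>x \<in> carrier L; y \<in> carrier L\<rbrakk> \<Longrightarrow> x \<curlyvee> (x \<curlywedge> y) = x"
    and meet_absorb: "\<lbrakk>x \<in> carrier L; y \<in> carrier L\<rbrakk> \<Longrightarrow> x \<curlywedge> (x \<curlyvee> y) = x"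

record 'a bdd_lattice_alg = "'a lattice_alg" +
  lbot :: 'a
  ltop :: 'a

locale alg_bdd_lattice = alg_lattice +
  assumes lbot_closed: "lbot L \<in> carrier L"
    and ltop_closed: "ltop L \<in> carrier L"
    and lbot_least: "x \<in> carrier L \<Longrightarrow> lbot L \<preceq> x"
    and ltop_greatest: "x \<in> carrier L \<Longrightarrow> x \<preceq> ltop L"

definition bdd_lattice_hom ::
    "('a, 'm) bdd_lattice_alg_scheme \<Rightarrow> ('b, 'n) bdd_lattice_alg_scheme \<Rightarrow> ('a \<Rightarrow> 'b) set"
  where "bdd_lattice_hom L M =
    {f \<in> carrier L \<rightarrow> carrier M.
       (\<forall>x\<in>carrier L. \<forall>y\<in>carrier L. f (x \<curlyvee>\<^bsub>L\<^esub> y) = f x \<curlyvee>\<^bsub>M\<^esub> f y) \<and>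
       (\<forall>x\<in>carrier L. \<forall>y\<in>carrier L. f (x \<curlywedge>\<^bsub>L\<^esub> y) = f x \<curlywedge>\<^bsub>M\<^esub> f y) \<and>
       f (lbot L) = lbot M \<and> f (ltop L) = ltop M}"


subsection \<open>Boolean algebras\<close>

record 'a boolean_alg = "'a bdd_lattice_alg" +
  bcompl :: "'a \<Rightarrow> 'a"

locale alg_boolean = alg_bdd_lattice +
  assumes meet_join_distrib: "\<lbrakk>x \<in> carrier L; y \<in> carrier L; z \<in> carrier L\<rbrakk>
                                \<Longrightarrow> x \<curlywedge> (y \<curlyvee> z) = (x \<curlywedge> y) \<curlyvee> (x \<curlywedge> z)"
    and bcompl_closed: "x \<in> carrier L \<Longrightarrow> bcompl L x \<in> carrier L"
    and join_bcompl: "x \<in> carrier L \<Longrightarrow> x \<curlyvee> bcompl L x = ltop L"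
    and meet_bcompl: "x \<in> carrier L \<Longrightarrow> x \<curlywedge> bcompl L x = lbot L"

definition boolean_hom ::
    "('a, 'm) boolean_alg_scheme \<Rightarrow> ('b, 'n) boolean_alg_scheme \<Rightarrow> ('a \<Rightarrow> 'b) set"
  where "boolean_hom B C =
    {h \<in> bdd_lattice_hom B C. \<forall>x\<in>carrier B. h (bcompl B x) = bcompl C (h x)}"


subsection \<open>Residuated lattices\<close>

record 'a res_lattice = "'a lattice_alg" +
  rmult :: "'a \<Rightarrow> 'a \<Rightarrow> 'a"  (infixl "\<star>\<index>" 75)
  rimp :: "'a \<Rightarrow> 'a \<Rightarrow> 'a"  (infixr "\<leadsto>\<index>" 60)
  rtop :: 'a

locale residuated_lattice = alg_lattice A for A (structure) +
  assumes rmult_comm_monoid: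
      "comm_monoid \<lparr>carrier = carrier A, monoid.mult = rmult A, one = rtop A\<rparr>"
    and rtop_greatest: "x \<in> carrier A \<Longrightarrow> x \<preceq> rtop A"
    and rimp_closed: "\<lbrakk>x \<in> carrier A; y \<in> carrier A\<rbrakk> \<Longrightarrow> x \<leadsto> y \<in> carrier A"
    and residuation: "\<lbrakk>x \<in> carrier A; y \<in> carrier A; z \<in> carrier A\<rbrakk>
                        \<Longrightarrow> x \<star> y \<preceq> z \<longleftrightarrow> x \<preceq> (y \<leadsto> z)"

definition res_lattice_hom ::
    "('a, 'm) res_lattice_scheme \<Rightarrow> ('b, 'n) res_lattice_scheme \<Rightarrow> ('a \<Rightarrow> 'b) set"
  where "res_lattice_hom A C =
    {k \<in> carrier A \<rightarrow> carrier C.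
       (\<forall>x\<in>carrier A. \<forall>y\<in>carrier A. k (x \<star>\<^bsub>A\<^esub> y) = k x \<star>\<^bsub>C\<^esub> k y) \<and>
       (\<forall>x\<in>carrier A. \<forall>y\<in>carrier A. k (x \<leadsto>\<^bsub>A\<^esub> y) = k x \<leadsto>\<^bsub>C\<^esub> k y) \<and>
       (\<forall>x\<in>carrier A. \<forall>y\<in>carrier A. k (x \<curlyvee>\<^bsub>A\<^esub> y) = k x \<curlyvee>\<^bsub>C\<^esub> k y) \<and>
       (\<forall>x\<in>carrier A. \<forall>y\<in>carrier A. k (x \<curlywedge>\<^bsub>A\<^esub> y) = k x \<curlywedge>\<^bsub>C\<^esub> k y) \<and>
       k (rtop A) = rtop C}"

record 'a bdd_res_lattice = "'a res_lattice" +
  rbot :: 'a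

definition rneg :: "('a, 'm) bdd_res_lattice_scheme \<Rightarrow> 'a \<Rightarrow> 'a"  ("\<sim>\<index> _" [81] 80)
  where "\<sim>\<^bsub>A\<^esub> x = x \<leadsto>\<^bsub>A\<^esub> rbot A"

locale bounded_residuated_lattice = residuated_lattice +
  assumes rbot_closed: "rbot A \<in> carrier A"
    and rbot_least: "x \<in> carrier A \<Longrightarrow> rbot A \<preceq> x"

locale stonean_residuated_lattice = bounded_residuated_lattice +
  assumes stonean: "x \<in> carrier A \<Longrightarrow> \<sim> x \<curlyvee> \<sim> (\<sim> x) = rtop A"

definition dense_part :: "'a bdd_res_lattice \<Rightarrow> 'a res_lattice"
  where "dense_part A =
    \<lparr>carrier = {x \<in> carrier A. \<sim>\<^bsub>A\<^esub> x = rbot A},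
     join_op = join_op A, meet_op = meet_op A,
     rmult = rmult A, rimp = rimp A, rtop = rtop A\<rparr>"

definition boolean_part :: "'a bdd_res_lattice \<Rightarrow> 'a boolean_alg"
  where "boolean_part A =
    \<lparr>carrier = {x \<in> carrier A. x \<curlyvee>\<^bsub>A\<^esub> \<sim>\<^bsub>A\<^esub> x = rtop A \<and> x \<curlywedge>\<^bsub>A\<^esub> \<sim>\<^bsub>A\<^esub> x = rbot A},
     join_op = join_op A, meet_op = meet_op A,
     lbot = rbot A, ltop = rtop A, bcompl = rneg A\<rparr>"


subsection \<open>Implicative filters\<close>

definition i_filter :: "('a, 'm) res_lattice_scheme \<Rightarrow> 'a set \<Rightarrow> bool"
  where "i_filter D F \<longleftrightarrow>
    F \<subseteq> carrier D \<and> rtop D \<in> F \<and>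
    (\<forall>x\<in>carrier D. \<forall>y\<in>carrier D. x \<in> F \<longrightarrow> x \<leadsto>\<^bsub>D\<^esub> y \<in> F \<longrightarrow> y \<in> F)"

definition i_filter_lattice :: "('a, 'm) res_lattice_scheme \<Rightarrow> 'a set bdd_lattice_alg"
  where "i_filter_lattice D =
    \<lparr>carrier = {F. i_filter D F},
     join_op = (\<lambda>F G. \<Inter>{H. i_filter D H \<and> F \<union> G \<subseteq> H}), meet_op = (\<inter>),
     lbot = {rtop D}, ltop = carrier D\<rparr>"

text \<open>The operations above are those of the inclusion order on i-filters.\<close>

lemma i_filter_lattice_le: "F \<preceq>\<^bsub>i_filter_lattice D\<^esub> G \<longleftrightarrow> F \<subseteq> G"
  by (auto simp: lattice_le_def i_filter_lattice_def)

lemma (in residuated_lattice) rtop_closed: "rtop A \<in> carrier A"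
  using monoid.one_closed[OF comm_monoid.axioms(1)[OF rmult_comm_monoid]] by simp

lemma (in residuated_lattice) i_filter_carrier: "i_filter A (carrier A)"
  by (simp add: i_filter_def rtop_closed)

lemma (in residuated_lattice) rtop_rimp:
  assumes "x \<in> carrier A" shows "rtop A \<leadsto> x = x"
proof -
  interpret M: comm_monoid "\<lparr>carrier = carrier A, monoid.mult = rmult A, one = rtop A\<rparr>"
    by (rule rmult_comm_monoid)
  have unit: "y \<star> rtop A = y" if "y \<in> carrier A" for y
    using M.r_one that by simp
  have refl: "y \<preceq> y" if "y \<in> carrier A" for y
    using that by (metis join_absorb lattice_le_def meet_absorb meet_closed)
  have c: "rtop A \<leadsto> x \<in> carrier A"
    by (simp add: assms rimp_closed rtop_closed)
  have "rtop A \<leadsto> x \<preceq> x"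
    using residuation[OF c rtop_closed assms] refl[OF c] unit[OF c] by simp
  moreover have "x \<preceq> (rtop A \<leadsto> x)"
    using residuation[OF assms rtop_closed assms] refl[OF assms] unit[OF assms] by simp
  ultimately show ?thesis
    by (metis assms c lattice_le_def meet_comm)
qed

lemma (in residuated_lattice) i_filter_rtop: "i_filter A {rtop A}"
  using rtop_rimp by (auto simp: i_filter_def rtop_closed)

lemma (in residuated_lattice) i_filter_join:
  assumes "i_filter A F" "i_filter A G"
  shows "i_filter A (F \<curlyvee>\<^bsub>i_filter_lattice A\<^esub> G)"
    and "F \<union> G \<subseteq> F \<curlyvee>\<^bsub>i_filter_lattice A\<^esub> G"
    and "\<lbrakk>i_filter A H; F \<subseteq> H; G \<subseteq> H\<rbrakk> \<Longrightarrow> F \<curlyvee>\<^bsub>i_filter_lattice A\<^esub> G \<subseteq> H"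
proof -
  have "F \<union> G \<subseteq> carrier A"
    using assms by (auto simp: i_filter_def)
  then have sub: "\<Inter>{H. i_filter A H \<and> F \<union> G \<subseteq> H} \<subseteq> carrier A"
    using i_filter_carrier by blast
  show "i_filter A (F \<curlyvee>\<^bsub>i_filter_lattice A\<^esub> G)"
    unfolding i_filter_def[of A "F \<curlyvee>\<^bsub>i_filter_lattice A\<^esub> G"]
  proof (intro conjI ballI impI)
    show "F \<curlyvee>\<^bsub>i_filter_lattice A\<^esub> G \<subseteq> carrier A"
      using sub by (simp add: i_filter_lattice_def)
    show "rtop A \<in> F \<curlyvee>\<^bsub>i_filter_lattice A\<^esub> G"
      by (simp add: i_filter_lattice_def i_filter_def)
  next
    fix x y assume "x \<in> carrier A" "y \<in> carrier A"
      and "x \<in> F \<curlyvee>\<^bsub>i_filter_lattice A\<^esub> G" "x \<leadsto> y \<in> F \<curlyvee>\<^bsub>i_filter_lattice A\<^esub> G"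
    then have "y \<in> H" if "i_filter A H" "F \<union> G \<subseteq> H" for H
      using that by (simp add: i_filter_lattice_def) (meson i_filter_def)
    then show "y \<in> F \<curlyvee>\<^bsub>i_filter_lattice A\<^esub> G"
      by (simp add: i_filter_lattice_def)
  qed
qed (auto simp: i_filter_lattice_def)

lemma (in residuated_lattice) i_filter_lattice: "alg_bdd_lattice (i_filter_lattice A)"
proof -
  let ?L = "i_filter_lattice A"
  have car: "F \<in> carrier ?L \<longleftrightarrow> i_filter A F" for F
    by (simp add: i_filter_lattice_def)
  have meet: "F \<curlywedge>\<^bsub>?L\<^esub> G = F \<inter> G" for F G
    by (simp add: i_filter_lattice_def)
  have meet_cl: "i_filter A (F \<inter> G)" if "i_filter A F" "i_filter A G" for F G
    using that unfolding i_filter_def by blast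
  show ?thesis
  proof (intro alg_bdd_lattice.intro alg_lattice.intro alg_bdd_lattice_axioms.intro,
      unfold car meet i_filter_lattice_le)
    fix F G assume "i_filter A F" "i_filter A G"
    then show "i_filter A (F \<curlyvee>\<^bsub>?L\<^esub> G)"
      by (rule i_filter_join(1))
  next
    fix F G assume "i_filter A F" "i_filter A G"
    then show "i_filter A (F \<inter> G)"
      by (rule meet_cl)
  next
    fix F G show "F \<curlyvee>\<^bsub>?L\<^esub> G = G \<curlyvee>\<^bsub>?L\<^esub> F"
      by (simp add: i_filter_lattice_def conj_commute)
  next
    fix F G :: "'a set" show "F \<inter> G = G \<inter> F"
      by (rule Int_commute)
  next
    fix F G H assume F: "i_filter A F" and G: "i_filter A G" and H: "i_filter A H"
    note FG = i_filter_join[OF F G] and GH = i_filter_join[OF G H]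
    note l = i_filter_join[OF FG(1) H] and r = i_filter_join[OF F GH(1)]
    show "(F \<curlyvee>\<^bsub>?L\<^esub> G) \<curlyvee>\<^bsub>?L\<^esub> H = F \<curlyvee>\<^bsub>?L\<^esub> (G \<curlyvee>\<^bsub>?L\<^esub> H)"
    proof (rule equalityI)
      show "(F \<curlyvee>\<^bsub>?L\<^esub> G) \<curlyvee>\<^bsub>?L\<^esub> H \<subseteq> F \<curlyvee>\<^bsub>?L\<^esub> (G \<curlyvee>\<^bsub>?L\<^esub> H)"
        using l(3)[OF r(1)] FG(3)[OF r(1)] r(2) GH(2) by (meson Un_subset_iff order_trans)
      show "F \<curlyvee>\<^bsub>?L\<^esub> (G \<curlyvee>\<^bsub>?L\<^esub> H) \<subseteq> (F \<curlyvee>\<^bsub>?L\<^esub> G) \<curlyvee>\<^bsub>?L\<^esub> H"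
        using r(3)[OF l(1)] GH(3)[OF l(1)] l(2) FG(2) by (meson Un_subset_iff order_trans)
    qed
  next
    fix F G H :: "'a set" show "F \<inter> G \<inter> H = F \<inter> (G \<inter> H)"
      by (rule Int_assoc)
  next
    fix F G assume F: "i_filter A F" and G: "i_filter A G"
    show "F \<curlyvee>\<^bsub>?L\<^esub> (F \<inter> G) = F"
      using i_filter_join(2)[OF F meet_cl[OF F G]] i_filter_join(3)[OF F meet_cl[OF F G] F]
      by (meson Int_lower1 Un_subset_iff order_refl subset_antisym)
    show "F \<inter> (F \<curlyvee>\<^bsub>?L\<^esub> G) = F"
      using i_filter_join(2)[OF F G] by (meson Int_absorb2 Un_subset_iff)
  next
    show "i_filter A (lbot ?L)" "i_filter A (ltop ?L)"
      by (simp_all add: i_filter_lattice_def i_filter_rtop i_filter_carrier)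
  next
    fix F assume "i_filter A F"
    then show "lbot ?L \<subseteq> F" "F \<subseteq> ltop ?L"
      by (simp_all add: i_filter_lattice_def i_filter_def)
  qed
qed


subsection \<open>The category of triples\<close>

definition phi_of :: "'a bdd_res_lattice \<Rightarrow> 'a \<Rightarrow> 'a set"
  where "phi_of A a = {x \<in> carrier (dense_part A). \<sim>\<^bsub>A\<^esub> a \<preceq>\<^bsub>A\<^esub> x}"

type_synonym ('b, 'd) triple = "'b boolean_alg \<times> 'd res_lattice \<times> ('b \<Rightarrow> 'd set)"

fun triple_obj :: "('b, 'd) triple \<Rightarrow> bool"
  where "triple_obj (B, D, \<phi>) \<longleftrightarrow>
    alg_boolean B \<and> residuated_lattice D \<and> \<phi> \<in> bdd_lattice_hom B (i_filter_lattice D)"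

fun triple_mor ::
    "('b, 'd) triple \<Rightarrow> ('c, 'e) triple \<Rightarrow> ('b \<Rightarrow> 'c) \<times> ('d \<Rightarrow> 'e) \<Rightarrow> bool"
  where "triple_mor (B1, D1, \<phi>1) (B2, D2, \<phi>2) (h, k) \<longleftrightarrow>
    triple_obj (B1, D1, \<phi>1) \<and> triple_obj (B2, D2, \<phi>2) \<and>
    h \<in> boolean_hom B1 B2 \<and> k \<in> res_lattice_hom D1 D2 \<and>
    (\<forall>a\<in>carrier B1. k ` \<phi>1 a \<subseteq> \<phi>2 (h a))"

text \<open>
  Morphisms are functions on carriers, so two of them are equal when they agree there;
  an isomorphism is a morphism with a two-sided inverse morphism.
\<close>

fun triple_iso :: "('b, 'd) triple \<Rightarrow> ('c, 'e) triple \<Rightarrow> bool"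
  where "triple_iso (B1, D1, \<phi>1) (B2, D2, \<phi>2) \<longleftrightarrow>
    (\<exists>h k h' k'.
       triple_mor (B1, D1, \<phi>1) (B2, D2, \<phi>2) (h, k) \<and>
       triple_mor (B2, D2, \<phi>2) (B1, D1, \<phi>1) (h', k') \<and>
       (\<forall>a\<in>carrier B1. h' (h a) = a) \<and> (\<forall>x\<in>carrier D1. k' (k x) = x) \<and>
       (\<forall>b\<in>carrier B2. h (h' b) = b) \<and> (\<forall>y\<in>carrier D2. k (k' y) = y))"

end

theory Submission
  imports Defs
begin

text \<open>
  Since \<open>\<phi>\<close> is a bounded lattice homomorphism, the i-filters \<open>\<phi> a\<close> and \<open>\<phi> (\<not>a)\<close> are complementary,
  so the residuated lattice \<open>D\<close> is their direct product and there is a projection \<open>p a\<close> of \<open>D\<close> onto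
  \<open>\<phi> a\<close> with kernel \<open>\<phi> (\<not>a)\<close>. These projections are closure operators and endomorphisms, with
  \<open>p a \<circ> p b = p (a \<and> b)\<close> and \<open>p a x \<and> p b x = p (a \<or> b) x\<close>. In a Stonean residuated lattice
  every element is \<open>a \<and> x\<close> for a unique Boolean \<open>a\<close> and a unique dense \<open>x \<ge> \<not>a\<close>, so \<open>A\<close> is built
  from the pairs \<open>(a, x)\<close> with \<open>x \<in> \<phi> a\<close>, ordered by \<open>(a, x) \<le> (b, y)\<close> iff \<open>a \<le> b\<close> and
  \<open>x \<le> p a y\<close>. Its Boolean elements are the \<open>(a, \<top>)\<close> and its dense elements the \<open>(\<top>, x)\<close>.
\<close>

section \<open>Lattices\<close>

text \<open>For the glued operations, bounds with respect to an order are easier to check than the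
  algebraic identities, associativity of the join above all. The second conclusion identifies
  \<open>R\<close> with the order that the meet defines.\<close>

lemma alg_lattice_of_order:
  fixes L (structure)
  assumes join_cl: "\<And>x y. \<lbrakk>x \<in> carrier L; y \<in> carrier L\<rbrakk> \<Longrightarrow> x \<curlyvee> y \<in> carrier L"
    and meet_cl: "\<And>x y. \<lbrakk>x \<in> carrier L; y \<in> carrier L\<rbrakk> \<Longrightarrow> x \<curlywedge> y \<in> carrier L"
    and refl: "\<And>x. x \<in> carrier L \<Longrightarrow> R x x"
    and trans: "\<And>x y z. \<lbrakk>x \<in> carrier L; y \<in> carrier L; z \<in> carrier L; R x y; R y z\<rbrakk> \<Longrightarrow> R x z"
    and antisym: "\<And>x y. \<lbrakk>x \<in> carrier L; y \<in> carrier L; R x y; R y x\<rbrakk> \<Longrightarrow> x = y"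
    and meet1: "\<And>x y. \<lbrakk>x \<in> carrier L; y \<in> carrier L\<rbrakk> \<Longrightarrow> R (x \<curlywedge> y) x"
    and meet2: "\<And>x y. \<lbrakk>x \<in> carrier L; y \<in> carrier L\<rbrakk> \<Longrightarrow> R (x \<curlywedge> y) y"
    and meetI: "\<And>x y z. \<lbrakk>x \<in> carrier L; y \<in> carrier L; z \<in> carrier L; R z x; R z y\<rbrakk>
                  \<Longrightarrow> R z (x \<curlywedge> y)"
    and join1: "\<And>x y. \<lbrakk>x \<in> carrier L; y \<in> carrier L\<rbrakk> \<Longrightarrow> R x (x \<curlyvee> y)"
    and join2: "\<And>x y. \<lbrakk>x \<in> carrier L; y \<in> carrier L\<rbrakk> \<Longrightarrow> R y (x \<curlyvee> y)"
    and joinI: "\<And>x y z. \<lbrakk>x \<in> carrier L; y \<in> carrier L; z \<in> carrier L; R x z; R y z\<rbrakk>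
                  \<Longrightarrow> R (x \<curlyvee> y) z"
  shows "alg_lattice L"
    and "\<lbrakk>x \<in> carrier L; y \<in> carrier L\<rbrakk> \<Longrightarrow> x \<preceq> y \<longleftrightarrow> R x y"
proof -
  show "alg_lattice L"
  proof
    fix x y assume xy: "x \<in> carrier L" "y \<in> carrier L"
    show "x \<curlyvee> y = y \<curlyvee> x" "x \<curlywedge> y = y \<curlywedge> x"
      using xy by (auto intro!: antisym joinI join1 join2 join_cl meetI meet1 meet2 meet_cl)
    show "x \<curlyvee> (x \<curlywedge> y) = x" "x \<curlywedge> (x \<curlyvee> y) = x"
      using xy by (auto intro!: antisym joinI join1 join_cl meetI meet1 meet_cl refl)
  next
    fix x y z assume xyz: "x \<in> carrier L" "y \<in> carrier L" "z \<in> carrier L"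
    note cl = xyz join_cl meet_cl
    have "R y (x \<curlyvee> y \<curlyvee> z)" "R x (x \<curlyvee> y \<curlyvee> z)" "R y (x \<curlyvee> (y \<curlyvee> z))" "R z (x \<curlyvee> (y \<curlyvee> z))"
      using trans[OF _ _ _ join2[of x y] join1[of "x \<curlyvee> y" z]]
        trans[OF _ _ _ join1[of x y] join1[of "x \<curlyvee> y" z]]
        trans[OF _ _ _ join1[of y z] join2[of x "y \<curlyvee> z"]]
        trans[OF _ _ _ join2[of y z] join2[of x "y \<curlyvee> z"]] by (simp_all add: cl)
    then show "x \<curlyvee> y \<curlyvee> z = x \<curlyvee> (y \<curlyvee> z)"
      by (intro antisym joinI cl join1[of x] join2[of _ z])
    have "R (x \<curlywedge> y \<curlywedge> z) y" "R (x \<curlywedge> y \<curlywedge> z) x" "R (x \<curlywedge> (y \<curlywedge> z)) y" "R (x \<curlywedge> (y \<curlywedge> z)) z"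
      using trans[OF _ _ _ meet1[of "x \<curlywedge> y" z] meet2[of x y]]
        trans[OF _ _ _ meet1[of "x \<curlywedge> y" z] meet1[of x y]]
        trans[OF _ _ _ meet2[of x "y \<curlywedge> z"] meet1[of y z]]
        trans[OF _ _ _ meet2[of x "y \<curlywedge> z"] meet2[of y z]] by (simp_all add: cl)
    then show "x \<curlywedge> y \<curlywedge> z = x \<curlywedge> (y \<curlywedge> z)"
      by (intro antisym meetI cl meet1[of x] meet2[of _ z])
  qed (fact join_cl meet_cl)+
  show "x \<preceq> y \<longleftrightarrow> R x y" if "x \<in> carrier L" "y \<in> carrier L"
    unfolding lattice_le_def using that by (metis antisym meet1 meet2 meetI meet_cl refl)
qed

context alg_lattice
begin

lemma le_refl: "x \<in> carrier L \<Longrightarrow> x \<preceq> x"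
  by (metis join_absorb lattice_le_def meet_absorb meet_closed)

lemma meet_idem: "x \<in> carrier L \<Longrightarrow> x \<curlywedge> x = x"
  using le_refl by (simp add: lattice_le_def)

lemma meet_left_idem: "\<lbrakk>x \<in> carrier L; y \<in> carrier L\<rbrakk> \<Longrightarrow> x \<curlywedge> (x \<curlywedge> y) = x \<curlywedge> y"
  by (simp add: meet_idem flip: meet_assoc)

lemma meet_left_comm:
  "\<lbrakk>x \<in> carrier L; y \<in> carrier L; z \<in> carrier L\<rbrakk> \<Longrightarrow> x \<curlywedge> (y \<curlywedge> z) = y \<curlywedge> (x \<curlywedge> z)"
  by (metis meet_assoc meet_comm)

lemmas meet_aci = meet_idem meet_left_idem meet_assoc meet_comm meet_left_comm

lemma le_trans:
  "\<lbrakk>x \<preceq> y; y \<preceq> z; x \<in> carrier L; y \<in> carrier L; z \<in> carrier L\<rbrakk> \<Longrightarrow> x \<preceq> z"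
  unfolding lattice_le_def by (metis meet_assoc)

lemma le_antisym: "\<lbrakk>x \<preceq> y; y \<preceq> x; x \<in> carrier L; y \<in> carrier L\<rbrakk> \<Longrightarrow> x = y"
  by (metis lattice_le_def meet_comm)

lemma meet_le1: "\<lbrakk>x \<in> carrier L; y \<in> carrier L\<rbrakk> \<Longrightarrow> x \<curlywedge> y \<preceq> x"
  by (metis lattice_le_def meet_assoc meet_comm le_refl meet_closed)

lemma meet_le2: "\<lbrakk>x \<in> carrier L; y \<in> carrier L\<rbrakk> \<Longrightarrow> x \<curlywedge> y \<preceq> y"
  by (metis meet_le1 meet_comm)

lemma le_meetI:
  "\<lbrakk>z \<preceq> x; z \<preceq> y; x \<in> carrier L; y \<in> carrier L; z \<in> carrier L\<rbrakk> \<Longrightarrow> z \<preceq> x \<curlywedge> y"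
  by (metis lattice_le_def meet_assoc)

lemma le_iff_join: "\<lbrakk>x \<in> carrier L; y \<in> carrier L\<rbrakk> \<Longrightarrow> x \<preceq> y \<longleftrightarrow> x \<curlyvee> y = y"
  by (metis lattice_le_def join_absorb join_comm meet_absorb meet_comm)

lemma le_join1: "\<lbrakk>x \<in> carrier L; y \<in> carrier L\<rbrakk> \<Longrightarrow> x \<preceq> x \<curlyvee> y"
  by (simp add: lattice_le_def meet_absorb)

lemma le_join2: "\<lbrakk>x \<in> carrier L; y \<in> carrier L\<rbrakk> \<Longrightarrow> y \<preceq> x \<curlyvee> y"
  by (metis le_join1 join_comm)

lemma join_leI:
  "\<lbrakk>x \<preceq> z; y \<preceq> z; x \<in> carrier L; y \<in> carrier L; z \<in> carrier L\<rbrakk> \<Longrightarrow> x \<curlyvee> y \<preceq> z"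
  by (metis le_iff_join join_assoc join_closed)

lemma meet_mono:
  "\<lbrakk>x \<preceq> x'; y \<preceq> y'; x \<in> carrier L; y \<in> carrier L; x' \<in> carrier L; y' \<in> carrier L\<rbrakk>
    \<Longrightarrow> x \<curlywedge> y \<preceq> x' \<curlywedge> y'"
  by (meson le_meetI le_trans meet_closed meet_le1 meet_le2)

end

section \<open>Complements and residuation in Boolean algebras\<close>

context alg_boolean
begin

lemma bot_join: "x \<in> carrier L \<Longrightarrow> lbot L \<curlyvee> x = x"
  using lbot_least le_iff_join lbot_closed by blast

lemma meet_top: "x \<in> carrier L \<Longrightarrow> x \<curlywedge> ltop L = x"
  using ltop_greatest by (simp add: lattice_le_def)

text \<open>The residuation law of the first components of the glued lattice. One direction splits
  \<open>c\<close> along \<open>a\<close> and its complement, the other distributes \<open>a\<close>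
  over the join.\<close>

lemma meet_le_iff_le_bcompl_join:
  assumes "a \<in> carrier L" "b \<in> carrier L" "c \<in> carrier L"
  shows "c \<curlywedge> a \<preceq> b \<longleftrightarrow> c \<preceq> bcompl L a \<curlyvee> b"
proof
  note cl = assms bcompl_closed join_closed meet_closed
  assume *: "c \<curlywedge> a \<preceq> b"
  have "c = c \<curlywedge> (bcompl L a \<curlyvee> a)"
    by (metis assms bcompl_closed join_bcompl join_comm meet_top)
  also have "\<dots> = (c \<curlywedge> bcompl L a) \<curlyvee> (c \<curlywedge> a)"
    by (simp add: meet_join_distrib cl)
  also have "\<dots> \<preceq> bcompl L a \<curlyvee> b"
    by (intro join_leI le_trans[OF meet_le2 le_join1] le_trans[OF * le_join2] cl)
  finally show "c \<preceq> bcompl L a \<curlyvee> b" .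
next
  note cl = assms bcompl_closed join_closed meet_closed
  assume "c \<preceq> bcompl L a \<curlyvee> b"
  then have "c \<curlywedge> a \<preceq> a \<curlywedge> (bcompl L a \<curlyvee> b)"
    by (meson cl le_meetI le_trans meet_le1 meet_le2)
  also have "a \<curlywedge> (bcompl L a \<curlyvee> b) = a \<curlywedge> b"
    by (simp add: meet_join_distrib cl meet_bcompl bot_join)
  finally show "c \<curlywedge> a \<preceq> b"
    by (meson cl le_trans meet_le2)
qed

text \<open>By the adjunction above with bottom on the right-hand side, it suffices that
  \<open>bcompl L b \<curlywedge> a\<close> is below bottom.\<close>

lemma bcompl_antimono:
  assumes "a \<preceq> b" "a \<in> carrier L" "b \<in> carrier L"
  shows "bcompl L b \<preceq> bcompl L a"
proof -
  note cl = assms bcompl_closed join_closed meet_closed lbot_closed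
  have "bcompl L b \<curlywedge> a \<preceq> bcompl L b \<curlywedge> b"
    by (intro meet_mono le_refl cl)
  then have "bcompl L b \<curlywedge> a \<preceq> lbot L"
    by (metis assms(3) bcompl_closed meet_bcompl meet_comm)
  then have "bcompl L b \<preceq> bcompl L a \<curlyvee> lbot L"
    by (simp add: meet_le_iff_le_bcompl_join cl)
  then show ?thesis
    by (metis bot_join join_comm cl(2) bcompl_closed lbot_closed)
qed

text \<open>Expanding \<open>b\<close> along \<open>a \<curlyvee> bcompl L a\<close> and
  \<open>bcompl L a\<close> along \<open>a \<curlyvee> b\<close>, both become
  \<open>b \<curlywedge> bcompl L a\<close>.\<close>

lemma bcompl_unique:
  assumes "a \<in> carrier L" "b \<in> carrier L" "a \<curlyvee> b = ltop L" "a \<curlywedge> b = lbot L"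
  shows "b = bcompl L a"
  by (metis assms bcompl_closed bot_join join_bcompl join_comm meet_bcompl meet_comm
      meet_join_distrib meet_top)

lemma bcompl_bcompl: "a \<in> carrier L \<Longrightarrow> bcompl L (bcompl L a) = a"
  by (metis bcompl_closed bcompl_unique join_bcompl join_comm meet_bcompl meet_comm)

lemma bcompl_top: "bcompl L (ltop L) = lbot L"
  by (metis bcompl_closed lattice_le_def ltop_closed ltop_greatest meet_bcompl meet_comm)

lemma bcompl_bot: "bcompl L (lbot L) = ltop L"
  by (metis bcompl_bcompl bcompl_top ltop_closed)

text \<open>Each of \<open>a\<close> and \<open>b\<close> lies below the complement of the left-hand
  side; join the two and take complements. This half of De Morgan's law controls the kernel of the
  projection for a join of indices.\<close>

lemma bcompl_meet_le:
  assumes "a \<in> carrier L" "b \<in> carrier L"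
  shows "bcompl L a \<curlywedge> bcompl L b \<preceq> bcompl L (a \<curlyvee> b)"
proof -
  note cl = assms bcompl_closed join_closed meet_closed
  let ?c = "bcompl L a \<curlywedge> bcompl L b"
  have "a \<preceq> bcompl L ?c" "b \<preceq> bcompl L ?c"
    by (metis assms bcompl_antimono bcompl_bcompl bcompl_closed meet_closed meet_le1,
        metis assms bcompl_antimono bcompl_bcompl bcompl_closed meet_closed meet_le2)
  then have "a \<curlyvee> b \<preceq> bcompl L ?c"
    by (intro join_leI cl)
  then show ?thesis
    by (metis assms bcompl_antimono bcompl_bcompl bcompl_closed join_closed meet_closed)
qed

end

section \<open>Residuated lattices and their i-filters\<close>

context residuated_lattice
begin

lemma rmult_closed: "\<lbrakk>x \<in> carrier A; y \<in> carrier A\<rbrakk> \<Longrightarrow> x \<star> y \<in> carrier A"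
  and rmult_assoc: "\<lbrakk>x \<in> carrier A; y \<in> carrier A; z \<in> carrier A\<rbrakk> \<Longrightarrow> x \<star> y \<star> z = x \<star> (y \<star> z)"
  and rmult_comm: "\<lbrakk>x \<in> carrier A; y \<in> carrier A\<rbrakk> \<Longrightarrow> x \<star> y = y \<star> x"
  and rmult_rtop: "x \<in> carrier A \<Longrightarrow> x \<star> rtop A = x"
proof -
  interpret M: comm_monoid "\<lparr>carrier = carrier A, monoid.mult = rmult A, one = rtop A\<rparr>"
    by (rule rmult_comm_monoid)
  show "\<lbrakk>x \<in> carrier A; y \<in> carrier A\<rbrakk> \<Longrightarrow> x \<star> y \<in> carrier A"
    "\<lbrakk>x \<in> carrier A; y \<in> carrier A; z \<in> carrier A\<rbrakk> \<Longrightarrow> x \<star> y \<star> z = x \<star> (y \<star> z)"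
    "\<lbrakk>x \<in> carrier A; y \<in> carrier A\<rbrakk> \<Longrightarrow> x \<star> y = y \<star> x"
    "x \<in> carrier A \<Longrightarrow> x \<star> rtop A = x"
    using M.m_closed M.m_assoc M.m_comm M.r_one by auto
qed

lemma rmult_left_comm:
  "\<lbrakk>x \<in> carrier A; y \<in> carrier A; z \<in> carrier A\<rbrakk> \<Longrightarrow> x \<star> (y \<star> z) = y \<star> (x \<star> z)"
  by (metis rmult_assoc rmult_comm)

lemmas rmult_ac = rmult_assoc rmult_comm rmult_left_comm

lemmas closed = rmult_closed rimp_closed meet_closed join_closed rtop_closed

lemma meet_rtop: "x \<in> carrier A \<Longrightarrow> x \<curlywedge> rtop A = x"
  using rtop_greatest by (simp add: lattice_le_def)

lemma rtop_meet: "x \<in> carrier A \<Longrightarrow> rtop A \<curlywedge> x = x"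
  by (metis meet_rtop meet_comm rtop_closed)

lemma rtop_le_iff: "x \<in> carrier A \<Longrightarrow> rtop A \<preceq> x \<longleftrightarrow> x = rtop A"
  by (metis rtop_greatest rtop_closed le_antisym le_refl)

lemma join_rtop: "x \<in> carrier A \<Longrightarrow> x \<curlyvee> rtop A = rtop A"
  using rtop_greatest le_iff_join rtop_closed by blast

lemma rimp_eq_rtop_iff:
  assumes "x \<in> carrier A" "y \<in> carrier A"
  shows "x \<leadsto> y = rtop A \<longleftrightarrow> x \<preceq> y"
  using residuation[OF rtop_closed assms] assms
  by (simp add: rtop_le_iff closed rmult_comm[OF rtop_closed] rmult_rtop)

lemma rimp_self: "x \<in> carrier A \<Longrightarrow> x \<leadsto> x = rtop A"
  by (simp add: rimp_eq_rtop_iff le_refl)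

lemma rimp_mult_le: "\<lbrakk>x \<in> carrier A; y \<in> carrier A\<rbrakk> \<Longrightarrow> (x \<leadsto> y) \<star> x \<preceq> y"
  by (simp add: residuation le_refl closed)

text \<open>The unit of the adjunction, \<open>y \<preceq> z \<leadsto> y \<star> z\<close>, carries
  \<open>x \<preceq> y\<close> through residuation.\<close>

lemma rmult_mono1:
  assumes "x \<preceq> y" "x \<in> carrier A" "y \<in> carrier A" "z \<in> carrier A"
  shows "x \<star> z \<preceq> y \<star> z"
proof -
  have "y \<preceq> z \<leadsto> y \<star> z"
    using assms by (simp add: le_refl closed flip: residuation)
  then have "x \<preceq> z \<leadsto> y \<star> z"
    by (rule le_trans[OF assms(1)]) (intro closed assms)+
  then show ?thesis
    using assms by (simp add: residuation closed)
qed

lemma rmult_mono: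
  assumes "x \<preceq> x'" "y \<preceq> y'"
    and cl: "x \<in> carrier A" "y \<in> carrier A" "x' \<in> carrier A" "y' \<in> carrier A"
  shows "x \<star> y \<preceq> x' \<star> y'"
proof -
  have "x \<star> y \<preceq> x' \<star> y"
    by (rule rmult_mono1) fact+
  moreover have "x' \<star> y \<preceq> x' \<star> y'"
    using rmult_mono1[OF assms(2) cl(2,4,3)] by (simp add: rmult_comm cl)
  ultimately show ?thesis
    by (rule le_trans) (intro closed cl)+
qed

lemma rmult_le1: "\<lbrakk>x \<in> carrier A; y \<in> carrier A\<rbrakk> \<Longrightarrow> x \<star> y \<preceq> x"
  using rmult_mono[OF le_refl rtop_greatest, of x y] by (simp add: rmult_rtop closed)

lemma rmult_le2: "\<lbrakk>x \<in> carrier A; y \<in> carrier A\<rbrakk> \<Longrightarrow> x \<star> y \<preceq> y"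
  by (metis rmult_le1 rmult_comm)

lemma le_rimp: "\<lbrakk>x \<in> carrier A; y \<in> carrier A\<rbrakk> \<Longrightarrow> y \<preceq> x \<leadsto> y"
  using residuation rmult_le1 by blast

lemma rimp_mono:
  assumes "x' \<preceq> x" "y \<preceq> y'"
    and cl: "x \<in> carrier A" "y \<in> carrier A" "x' \<in> carrier A" "y' \<in> carrier A"
  shows "x \<leadsto> y \<preceq> x' \<leadsto> y'"
proof -
  have "(x \<leadsto> y) \<star> x' \<preceq> (x \<leadsto> y) \<star> x"
    by (intro rmult_mono le_refl closed cl assms)
  then have "(x \<leadsto> y) \<star> x' \<preceq> y"
    by (rule le_trans[OF _ rimp_mult_le]) (intro closed cl)+
  then have "(x \<leadsto> y) \<star> x' \<preceq> y'"
    by (rule le_trans[OF _ assms(2)]) (intro closed cl)+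
  then show ?thesis
    by (simp add: residuation closed cl)
qed

lemma rimp_trans:
  assumes "x \<in> carrier A" "y \<in> carrier A" "z \<in> carrier A"
  shows "(x \<leadsto> y) \<star> (y \<leadsto> z) \<preceq> x \<leadsto> z"
proof -
  have "(x \<leadsto> y) \<star> (y \<leadsto> z) \<star> x = (y \<leadsto> z) \<star> ((x \<leadsto> y) \<star> x)"
    by (simp add: rmult_ac closed assms)
  also have "\<dots> \<preceq> (y \<leadsto> z) \<star> y"
    by (intro rmult_mono le_refl rimp_mult_le closed assms)
  finally have "(x \<leadsto> y) \<star> (y \<leadsto> z) \<star> x \<preceq> z"
    by (rule le_trans[OF _ rimp_mult_le]) (intro closed assms)+
  then show ?thesis
    by (simp add: residuation closed assms)
qed

text \<open>This and the next two inequalities make congruence modulo an i-filter compatible with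
  product, meet and implication: a product of implications from the filter lies below the
  implication between the results.\<close>

lemma rmult_rimp_compat:
  assumes cl: "x \<in> carrier A" "y \<in> carrier A" "x' \<in> carrier A" "y' \<in> carrier A"
  shows "(x \<leadsto> x') \<star> (y \<leadsto> y') \<preceq> x \<star> y \<leadsto> x' \<star> y'"
proof -
  have "(x \<leadsto> x') \<star> (y \<leadsto> y') \<star> (x \<star> y) = ((x \<leadsto> x') \<star> x) \<star> ((y \<leadsto> y') \<star> y)"
    by (simp add: rmult_ac closed cl)
  also have "\<dots> \<preceq> x' \<star> y'"
    by (intro rmult_mono rimp_mult_le closed cl)
  finally show ?thesis
    by (simp add: residuation closed cl)
qed

lemma meet_rimp_compat:
  assumes cl: "x \<in> carrier A" "y \<in> carrier A" "x' \<in> carrier A" "y' \<in> carrier A"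
  shows "(x \<leadsto> x') \<star> (y \<leadsto> y') \<preceq> x \<curlywedge> y \<leadsto> x' \<curlywedge> y'"
proof -
  have *: "(x \<leadsto> x') \<star> (y \<leadsto> y') \<star> (x \<curlywedge> y) \<preceq> (x \<leadsto> x') \<star> x"
    "(x \<leadsto> x') \<star> (y \<leadsto> y') \<star> (x \<curlywedge> y) \<preceq> (y \<leadsto> y') \<star> y"
    by (intro rmult_mono rmult_le1 rmult_le2 meet_le1 meet_le2 closed cl)+
  have "(x \<leadsto> x') \<star> (y \<leadsto> y') \<star> (x \<curlywedge> y) \<preceq> x' \<curlywedge> y'"
    by (intro le_meetI le_trans[OF *(1) rimp_mult_le] le_trans[OF *(2) rimp_mult_le] closed cl)
  then show ?thesis
    by (simp add: residuation closed cl)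
qed

lemma rimp_rimp_compat:
  assumes cl: "x \<in> carrier A" "y \<in> carrier A" "x' \<in> carrier A" "y' \<in> carrier A"
  shows "(x' \<leadsto> x) \<star> (y \<leadsto> y') \<preceq> (x \<leadsto> y) \<leadsto> (x' \<leadsto> y')"
proof -
  have "(x' \<leadsto> x) \<star> (y \<leadsto> y') \<star> (x \<leadsto> y) = (x' \<leadsto> x) \<star> (x \<leadsto> y) \<star> (y \<leadsto> y')"
    by (simp add: rmult_ac closed cl)
  also have "\<dots> \<preceq> (x' \<leadsto> y) \<star> (y \<leadsto> y')"
    by (intro rmult_mono rimp_trans le_refl closed cl)
  finally have "(x' \<leadsto> x) \<star> (y \<leadsto> y') \<star> (x \<leadsto> y) \<preceq> x' \<leadsto> y'"
    by (rule le_trans[OF _ rimp_trans]) (intro closed cl)+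
  then show ?thesis
    by (simp add: residuation closed cl)
qed

section \<open>Implicative filters, their joins and their congruences\<close>

lemma i_filter_in_carrier: "\<lbrakk>i_filter A F; x \<in> F\<rbrakk> \<Longrightarrow> x \<in> carrier A"
  by (auto simp: i_filter_def)

lemma i_filter_up:
  assumes "i_filter A F" "x \<in> F" "x \<preceq> y" "y \<in> carrier A" shows "y \<in> F"
proof -
  have "x \<in> carrier A"
    using assms i_filter_in_carrier by blast
  then have "x \<leadsto> y = rtop A"
    using assms rimp_eq_rtop_iff by blast
  then show ?thesis
    using assms \<open>x \<in> carrier A\<close> by (metis i_filter_def)
qed

text \<open>\<open>x\<close> lies below \<open>y \<leadsto> x \<star> y\<close>, so upward closure
  and then modus ponens with \<open>y\<close> give the product.\<close>

lemma i_filter_rmult: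
  assumes "i_filter A F" "x \<in> F" "y \<in> F" shows "x \<star> y \<in> F"
proof -
  have cl: "x \<in> carrier A" "y \<in> carrier A"
    using assms i_filter_in_carrier by blast+
  have "x \<preceq> y \<leadsto> x \<star> y"
    using cl by (simp add: le_refl closed flip: residuation)
  then have "y \<leadsto> x \<star> y \<in> F"
    using i_filter_up assms cl closed by blast
  then show ?thesis
    using assms cl by (metis closed(1) i_filter_def)
qed

lemma i_filter_meet: "\<lbrakk>i_filter A F; x \<in> F; y \<in> F\<rbrakk> \<Longrightarrow> x \<curlywedge> y \<in> F"
  by (meson i_filter_up i_filter_rmult rmult_le1 rmult_le2 le_meetI closed i_filter_in_carrier)

lemma i_filter_rimp: "\<lbrakk>i_filter A F; y \<in> F; x \<in> carrier A\<rbrakk> \<Longrightarrow> x \<leadsto> y \<in> F"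
  by (meson i_filter_up le_rimp closed i_filter_in_carrier)

text \<open>The elements above some product \<open>u \<star> v\<close> already form an i-filter
  containing \<open>F\<close> and \<open>G\<close>, so the join is contained in it; conversely, the
  join is closed under products and upwards.\<close>

lemma in_i_filter_join_iff:
  assumes F: "i_filter A F" and G: "i_filter A G"
  shows "x \<in> F \<curlyvee>\<^bsub>i_filter_lattice A\<^esub> G \<longleftrightarrow>
         x \<in> carrier A \<and> (\<exists>u\<in>F. \<exists>v\<in>G. u \<star> v \<preceq> x)"
proof
  let ?H = "{x \<in> carrier A. \<exists>u\<in>F. \<exists>v\<in>G. u \<star> v \<preceq> x}"
  note cl = i_filter_in_carrier[OF F] i_filter_in_carrier[OF G] closed
  have top: "rtop A \<in> F" "rtop A \<in> G"
    using F G by (auto simp: i_filter_def)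
  have "i_filter A ?H"
    unfolding i_filter_def
  proof (intro conjI ballI impI)
    show "rtop A \<in> ?H"
      using top rtop_greatest cl by blast
    fix x y assume xy: "x \<in> carrier A" "y \<in> carrier A" and "x \<in> ?H" "x \<leadsto> y \<in> ?H"
    then obtain u v u' v' where uv: "u \<in> F" "v \<in> G" "u \<star> v \<preceq> x"
      and uv': "u' \<in> F" "v' \<in> G" "u' \<star> v' \<preceq> x \<leadsto> y"
      by blast
    have c: "u \<in> carrier A" "v \<in> carrier A" "u' \<in> carrier A" "v' \<in> carrier A"
      using uv uv' cl by blast+
    \<comment> \<open>The left side collects the factors from \<open>F\<close> and those from
      \<open>G\<close>; the right side is grouped for modus ponens,
      \<open>(x \<leadsto> y) \<star> x \<preceq> y\<close>.\<close>
    have "(u' \<star> u) \<star> (v' \<star> v) = (u' \<star> v') \<star> (u \<star> v)"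
      by (simp add: rmult_ac closed c)
    also have "\<dots> \<preceq> (x \<leadsto> y) \<star> x"
      by (intro rmult_mono uv uv' xy c closed)
    finally have "(u' \<star> u) \<star> (v' \<star> v) \<preceq> y"
      by (meson le_trans rimp_mult_le closed c xy)
    then show "y \<in> ?H"
      using xy uv uv' i_filter_rmult F G by blast
  qed auto
  moreover have "u \<star> rtop A \<preceq> u" "rtop A \<star> u \<preceq> u" if "u \<in> carrier A" for u
    using that rmult_le1 rmult_le2 rtop_closed by blast+
  then have "F \<subseteq> ?H" "G \<subseteq> ?H"
    using top cl by blast+
  ultimately have "F \<curlyvee>\<^bsub>i_filter_lattice A\<^esub> G \<subseteq> ?H"
    by (rule i_filter_join(3)[OF F G])
  then show "x \<in> carrier A \<and> (\<exists>u\<in>F. \<exists>v\<in>G. u \<star> v \<preceq> x)"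
    if "x \<in> F \<curlyvee>\<^bsub>i_filter_lattice A\<^esub> G" using that by blast
next
  assume "x \<in> carrier A \<and> (\<exists>u\<in>F. \<exists>v\<in>G. u \<star> v \<preceq> x)"
  then show "x \<in> F \<curlyvee>\<^bsub>i_filter_lattice A\<^esub> G"
    using i_filter_join(1,2)[OF F G] i_filter_up i_filter_rmult by blast
qed

text \<open>Equality in the quotient of \<open>A\<close> by \<open>F\<close>. The quotient itself is
  never formed; only representatives are compared.\<close>

definition filter_cong :: "'a set \<Rightarrow> 'a \<Rightarrow> 'a \<Rightarrow> bool"
  where "filter_cong F x y \<longleftrightarrow> x \<leadsto> y \<in> F \<and> y \<leadsto> x \<in> F"

lemma filter_cong_refl: "\<lbrakk>i_filter A F; x \<in> carrier A\<rbrakk> \<Longrightarrow> filter_cong F x x"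
  by (simp add: filter_cong_def rimp_self i_filter_def)

lemma filter_cong_sym: "filter_cong F x y \<Longrightarrow> filter_cong F y x"
  by (simp add: filter_cong_def)

lemma filter_cong_trans:
  assumes "i_filter A F" "filter_cong F x y" "filter_cong F y z"
    and "x \<in> carrier A" "y \<in> carrier A" "z \<in> carrier A"
  shows "filter_cong F x z"
  using assms unfolding filter_cong_def
  by (meson i_filter_up i_filter_rmult rimp_trans closed)

lemma filter_cong_mono: "\<lbrakk>filter_cong F x y; F \<subseteq> G\<rbrakk> \<Longrightarrow> filter_cong G x y"
  by (auto simp: filter_cong_def)

lemma filter_cong_compat:
  assumes F: "i_filter A F" and xy: "filter_cong F x x'" "filter_cong F y y'"
    and cl: "x \<in> carrier A" "y \<in> carrier A" "x' \<in> carrier A" "y' \<in> carrier A"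
  shows "filter_cong F (x \<star> y) (x' \<star> y')" "filter_cong F (x \<curlywedge> y) (x' \<curlywedge> y')"
    "filter_cong F (x \<leadsto> y) (x' \<leadsto> y')"
proof -
  \<comment> \<open>Lower bounds in \<open>F\<close> for the six implications to be shown. The two
    mixed products serve the third claim, since implication reverses the order in its left
    argument.\<close>
  have m: "(x \<leadsto> x') \<star> (y \<leadsto> y') \<in> F" "(x' \<leadsto> x) \<star> (y' \<leadsto> y) \<in> F"
    "(x' \<leadsto> x) \<star> (y \<leadsto> y') \<in> F" "(x \<leadsto> x') \<star> (y' \<leadsto> y) \<in> F"
    using xy i_filter_rmult[OF F] by (auto simp: filter_cong_def)
  show "filter_cong F (x \<star> y) (x' \<star> y')" "filter_cong F (x \<curlywedge> y) (x' \<curlywedge> y')"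
    "filter_cong F (x \<leadsto> y) (x' \<leadsto> y')"
    unfolding filter_cong_def
    by (intro conjI i_filter_up[OF F m(1)] i_filter_up[OF F m(2)] i_filter_up[OF F m(3)]
        i_filter_up[OF F m(4)] rmult_rimp_compat meet_rimp_compat
        rimp_rimp_compat closed cl)+
qed

end

section \<open>Transport along isomorphisms\<close>

text \<open>The lattice axioms are identities, so they pass along a surjective homomorphism. This
  and the following lemmas obtain the structure of the Boolean and dense parts of the glued lattice
  from \<open>B\<close> and \<open>D\<close>.\<close>

lemma alg_lattice_image:
  assumes "alg_lattice L" and carrier: "carrier M = f ` carrier L"
    and join: "\<And>x y. \<lbrakk>x \<in> carrier L; y \<in> carrier L\<rbrakk> \<Longrightarrow> f x \<curlyvee>\<^bsub>M\<^esub> f y = f (x \<curlyvee>\<^bsub>L\<^esub> y)"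
    and meet: "\<And>x y. \<lbrakk>x \<in> carrier L; y \<in> carrier L\<rbrakk> \<Longrightarrow> f x \<curlywedge>\<^bsub>M\<^esub> f y = f (x \<curlywedge>\<^bsub>L\<^esub> y)"
  shows "alg_lattice M"
proof -
  interpret alg_lattice L by fact
  note cl = join_closed meet_closed
  show ?thesis
  proof (intro alg_lattice.intro, unfold carrier; elim imageE; hypsubst)
  qed (simp_all add: join meet cl join_absorb meet_absorb join_assoc meet_assoc,
       simp_all add: join_comm meet_comm)
qed

text \<open>Residuation is an equivalence of inequalities; it transfers because an injective meet
  homomorphism also reflects the order.\<close>

lemma residuated_lattice_image:
  assumes "residuated_lattice D" and k: "k \<in> res_lattice_hom D E"
    and inj: "inj_on k (carrier D)" and carrier: "carrier E = k ` carrier D"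
  shows "residuated_lattice E"
proof -
  interpret residuated_lattice D by fact
  have hom: "k x \<curlyvee>\<^bsub>E\<^esub> k y = k (x \<curlyvee>\<^bsub>D\<^esub> y)" "k x \<curlywedge>\<^bsub>E\<^esub> k y = k (x \<curlywedge>\<^bsub>D\<^esub> y)"
    "k x \<star>\<^bsub>E\<^esub> k y = k (x \<star>\<^bsub>D\<^esub> y)" "k x \<leadsto>\<^bsub>E\<^esub> k y = k (x \<leadsto>\<^bsub>D\<^esub> y)"
    if "x \<in> carrier D" "y \<in> carrier D" for x y
    using that k by (auto simp: res_lattice_hom_def)
  have top: "rtop E = k (rtop D)"
    using k by (auto simp: res_lattice_hom_def)
  have le: "k x \<preceq>\<^bsub>E\<^esub> k y \<longleftrightarrow> x \<preceq>\<^bsub>D\<^esub> y" if "x \<in> carrier D" "y \<in> carrier D" for x y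
    using that inj by (simp add: lattice_le_def hom inj_on_eq_iff closed)
  show ?thesis
  proof (intro residuated_lattice.intro residuated_lattice_axioms.intro)
    show "alg_lattice E"
      by (rule alg_lattice_image[OF alg_lattice_axioms carrier]) (simp_all add: hom)
    show "comm_monoid \<lparr>carrier = carrier E, monoid.mult = rmult E, one = rtop E\<rparr>"
      by (rule comm_monoidI)
        (auto simp: carrier top hom closed rmult_rtop rmult_ac)
    show "x \<preceq>\<^bsub>E\<^esub> rtop E" if "x \<in> carrier E" for x
      using that by (auto simp: carrier top le rtop_greatest closed)
    show "x \<leadsto>\<^bsub>E\<^esub> y \<in> carrier E" if "x \<in> carrier E" "y \<in> carrier E" for x y
      using that by (auto simp: carrier hom closed)
    show "x \<star>\<^bsub>E\<^esub> y \<preceq>\<^bsub>E\<^esub> z \<longleftrightarrow> x \<preceq>\<^bsub>E\<^esub> (y \<leadsto>\<^bsub>E\<^esub> z)"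
      if "x \<in> carrier E" "y \<in> carrier E" "z \<in> carrier E" for x y z
      using that by (auto simp: carrier hom closed le residuation)
  qed
qed

lemma alg_boolean_image:
  assumes "alg_boolean B" and h: "h \<in> boolean_hom B C" and carrier: "carrier C = h ` carrier B"
  shows "alg_boolean C"
proof -
  interpret alg_boolean B by fact
  have hom: "h x \<curlyvee>\<^bsub>C\<^esub> h y = h (x \<curlyvee>\<^bsub>B\<^esub> y)" "h x \<curlywedge>\<^bsub>C\<^esub> h y = h (x \<curlywedge>\<^bsub>B\<^esub> y)"
    if "x \<in> carrier B" "y \<in> carrier B" for x y
    using that h by (auto simp: boolean_hom_def bdd_lattice_hom_def)
  have const: "lbot C = h (lbot B)" "ltop C = h (ltop B)"
    using h by (auto simp: boolean_hom_def bdd_lattice_hom_def)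
  have compl: "bcompl C (h x) = h (bcompl B x)" if "x \<in> carrier B" for x
    using that h by (auto simp: boolean_hom_def)
  note cl = join_closed meet_closed bcompl_closed lbot_closed ltop_closed
  have least: "lbot B \<curlywedge>\<^bsub>B\<^esub> x = lbot B" "x \<curlywedge>\<^bsub>B\<^esub> ltop B = x" if "x \<in> carrier B" for x
    using that lbot_least ltop_greatest by (auto simp: lattice_le_def)
  show ?thesis
  proof (intro alg_boolean.intro alg_bdd_lattice.intro alg_bdd_lattice_axioms.intro
      alg_boolean_axioms.intro)
    show "alg_lattice C"
      by (rule alg_lattice_image[OF alg_lattice_axioms carrier]) (simp_all add: hom)
  qed (auto simp: carrier hom const compl cl least lattice_le_def meet_join_distrib join_bcompl
        meet_bcompl)
qed

lemma i_filter_image_iff: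
  assumes "residuated_lattice D" and k: "k \<in> res_lattice_hom D E"
    and inj: "inj_on k (carrier D)" and carrier: "carrier E = k ` carrier D"
    and F: "F \<subseteq> carrier D"
  shows "i_filter E (k ` F) \<longleftrightarrow> i_filter D F"
proof -
  interpret residuated_lattice D by fact
  have hom: "k x \<leadsto>\<^bsub>E\<^esub> k y = k (x \<leadsto>\<^bsub>D\<^esub> y)" if "x \<in> carrier D" "y \<in> carrier D" for x y
    using that k by (auto simp: res_lattice_hom_def)
  have top: "rtop E = k (rtop D)"
    using k by (auto simp: res_lattice_hom_def)
  have mem: "k x \<in> k ` F \<longleftrightarrow> x \<in> F" if "x \<in> carrier D" for x
    using inj_on_image_mem_iff[OF inj that F] .
  show ?thesis
    unfolding i_filter_def carrier top using F
    by (simp add: mem hom closed image_mono)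
qed

text \<open>Taking images under the bijection \<open>k\<close> matches the i-filters of
  \<open>D\<close> with those of \<open>E\<close> and respects inclusion, hence least upper
  bounds.\<close>

lemma i_filter_join_image:
  assumes D: "residuated_lattice D" and k: "k \<in> res_lattice_hom D E"
    and inj: "inj_on k (carrier D)" and carrier: "carrier E = k ` carrier D"
    and F: "i_filter D F" and G: "i_filter D G"
  shows "k ` F \<curlyvee>\<^bsub>i_filter_lattice E\<^esub> k ` G = k ` (F \<curlyvee>\<^bsub>i_filter_lattice D\<^esub> G)"
proof -
  interpret D: residuated_lattice D by fact
  interpret E: residuated_lattice E
    by (rule residuated_lattice_image[OF D k inj carrier])
  note iff = i_filter_image_iff[OF D k inj carrier]
  have sub: "H \<subseteq> carrier D" if "i_filter D H" for H
    using that by (simp add: i_filter_def)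
  note joinD = D.i_filter_join[OF F G]
  have kF: "i_filter E (k ` F)" and kG: "i_filter E (k ` G)"
    using iff sub F G by auto
  note joinE = E.i_filter_join[OF kF kG]
  show ?thesis
  proof
    have "i_filter E (k ` (F \<curlyvee>\<^bsub>i_filter_lattice D\<^esub> G))"
      using iff joinD(1) sub by blast
    then show "k ` F \<curlyvee>\<^bsub>i_filter_lattice E\<^esub> k ` G \<subseteq> k ` (F \<curlyvee>\<^bsub>i_filter_lattice D\<^esub> G)"
      using joinD(2) by (intro joinE(3) image_mono) auto
  next
    let ?J = "k ` F \<curlyvee>\<^bsub>i_filter_lattice E\<^esub> k ` G"
    \<comment> \<open>The preimage of the join in \<open>E\<close>: an i-filter of \<open>D\<close>
      above \<open>F\<close> and \<open>G\<close>, hence above their join in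
      \<open>D\<close>.\<close>
    define H where "H = {x \<in> carrier D. k x \<in> ?J}"
    have "?J \<subseteq> k ` carrier D"
      using joinE(1) by (simp add: i_filter_def carrier)
    then have J: "?J = k ` H"
      by (auto simp: H_def)
    have "H \<subseteq> carrier D"
      by (auto simp: H_def)
    then have "i_filter D H"
      using iff J joinE(1) by metis
    moreover have "F \<subseteq> H" "G \<subseteq> H"
      using joinE(2) sub[OF F] sub[OF G] by (auto simp: H_def)
    ultimately show "k ` (F \<curlyvee>\<^bsub>i_filter_lattice D\<^esub> G) \<subseteq> ?J"
      unfolding J by (intro image_mono joinD(3))
  qed
qed

text \<open>A morphism of triples asks only for an inclusion between filters, so a bijective one
  need not be an isomorphism. Here \<open>\<psi> (h a)\<close> equals the image of
  \<open>\<phi> a\<close>, which makes the inverse pair a morphism as well.\<close>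

lemma triple_iso_image:
  assumes obj: "triple_obj (B, D, \<phi>)"
    and h: "h \<in> boolean_hom B C" "inj_on h (carrier B)" "carrier C = h ` carrier B"
    and k: "k \<in> res_lattice_hom D E" "inj_on k (carrier D)" "carrier E = k ` carrier D"
    and \<psi>: "\<And>a. a \<in> carrier B \<Longrightarrow> \<psi> (h a) = k ` \<phi> a"
  shows "triple_iso (C, E, \<psi>) (B, D, \<phi>)"
proof -
  let ?h = "inv_into (carrier B) h" and ?k = "inv_into (carrier D) k"
  have B: "alg_boolean B" and D: "residuated_lattice D"
    and \<phi>: "\<phi> \<in> bdd_lattice_hom B (i_filter_lattice D)"
    using obj by auto
  interpret B: alg_boolean B by fact
  interpret D: residuated_lattice D by fact
  have \<phi>_filter: "i_filter D (\<phi> a)" if "a \<in> carrier B" for a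
    using \<phi> that by (auto simp: bdd_lattice_hom_def i_filter_lattice_def)
  have \<phi>_sub: "\<phi> a \<subseteq> carrier D" if "a \<in> carrier B" for a
    using \<phi>_filter[OF that] by (simp add: i_filter_def)
  have \<phi>_hom: "\<phi> (lbot B) = {rtop D}" "\<phi> (ltop B) = carrier D"
    "\<And>a b. \<lbrakk>a \<in> carrier B; b \<in> carrier B\<rbrakk> \<Longrightarrow> \<phi> (a \<curlywedge>\<^bsub>B\<^esub> b) = \<phi> a \<inter> \<phi> b"
    "\<And>a b. \<lbrakk>a \<in> carrier B; b \<in> carrier B\<rbrakk>
      \<Longrightarrow> \<phi> (a \<curlyvee>\<^bsub>B\<^esub> b) = \<phi> a \<curlyvee>\<^bsub>i_filter_lattice D\<^esub> \<phi> b"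
    using \<phi> by (auto simp: bdd_lattice_hom_def i_filter_lattice_def)
  have h_hom: "h x \<curlyvee>\<^bsub>C\<^esub> h y = h (x \<curlyvee>\<^bsub>B\<^esub> y)" "h x \<curlywedge>\<^bsub>C\<^esub> h y = h (x \<curlywedge>\<^bsub>B\<^esub> y)"
    "bcompl C (h x) = h (bcompl B x)"
    if "x \<in> carrier B" "y \<in> carrier B" for x y
    using that h by (auto simp: boolean_hom_def bdd_lattice_hom_def)
  have h_const: "lbot C = h (lbot B)" "ltop C = h (ltop B)"
    using h by (auto simp: boolean_hom_def bdd_lattice_hom_def)
  have k_hom: "k x \<curlyvee>\<^bsub>E\<^esub> k y = k (x \<curlyvee>\<^bsub>D\<^esub> y)" "k x \<curlywedge>\<^bsub>E\<^esub> k y = k (x \<curlywedge>\<^bsub>D\<^esub> y)"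
    "k x \<star>\<^bsub>E\<^esub> k y = k (x \<star>\<^bsub>D\<^esub> y)" "k x \<leadsto>\<^bsub>E\<^esub> k y = k (x \<leadsto>\<^bsub>D\<^esub> y)"
    if "x \<in> carrier D" "y \<in> carrier D" for x y
    using that k by (auto simp: res_lattice_hom_def)
  have k_top: "rtop E = k (rtop D)"
    using k by (auto simp: res_lattice_hom_def)
  have "\<psi> \<in> bdd_lattice_hom C (i_filter_lattice E)"
    unfolding bdd_lattice_hom_def
  proof (intro CollectI conjI ballI funcsetI)
    fix c assume "c \<in> carrier C"
    then show "\<psi> c \<in> carrier (i_filter_lattice E)"
      using i_filter_image_iff[OF D k] \<phi>_filter \<phi>_sub
      by (auto simp: h(3) \<psi> i_filter_lattice_def)
  next
    fix c d assume "c \<in> carrier C" "d \<in> carrier C"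
    then obtain a b where ab: "a \<in> carrier B" "b \<in> carrier B" and c: "c = h a" "d = h b"
      by (auto simp: h(3))
    show "\<psi> (c \<curlyvee>\<^bsub>C\<^esub> d) = \<psi> c \<curlyvee>\<^bsub>i_filter_lattice E\<^esub> \<psi> d"
      using ab i_filter_join_image[OF D k \<phi>_filter \<phi>_filter]
      by (simp add: c h_hom \<psi> B.join_closed \<phi>_hom)
    show "\<psi> (c \<curlywedge>\<^bsub>C\<^esub> d) = \<psi> c \<curlywedge>\<^bsub>i_filter_lattice E\<^esub> \<psi> d"
      using ab inj_on_image_Int[OF k(2) \<phi>_sub \<phi>_sub]
      by (simp add: c h_hom \<psi> B.meet_closed \<phi>_hom i_filter_lattice_def)
  qed (simp_all add: h_const \<psi> B.lbot_closed B.ltop_closed \<phi>_hom i_filter_lattice_def k_top k(3))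
  then have obj': "triple_obj (C, E, \<psi>)"
    using alg_boolean_image[OF B h(1,3)] residuated_lattice_image[OF D k] by simp
  have "?h \<in> boolean_hom C B"
    using h(2) by (auto simp: boolean_hom_def bdd_lattice_hom_def h(3) h_hom h_const
        B.join_closed B.meet_closed B.bcompl_closed B.lbot_closed B.ltop_closed)
  moreover have "?k \<in> res_lattice_hom E D"
    using k(2) by (auto simp: res_lattice_hom_def k(3) k_hom k_top D.closed)
  moreover have "?k ` \<psi> c \<subseteq> \<phi> (?h c)" if "c \<in> carrier C" for c
    using that h(2) k(2) \<phi>_sub by (auto simp: h(3) \<psi> subset_iff)
  ultimately have "triple_mor (C, E, \<psi>) (B, D, \<phi>) (?h, ?k)"
    using obj obj' by simp
  moreover have "triple_mor (B, D, \<phi>) (C, E, \<psi>) (h, k)"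
    using obj obj' h k \<psi> by simp
  ultimately show ?thesis
    using h k by (auto intro!: exI[of _ ?h] exI[of _ ?k] exI[of _ h] exI[of _ k]
        simp del: triple_mor.simps)
qed

section \<open>Gluing a triple\<close>

locale lattice_triple = B: alg_boolean B + D: residuated_lattice D
  for B :: "'b boolean_alg" and D :: "'d res_lattice" +
  fixes \<phi> :: "'b \<Rightarrow> 'd set"
  assumes phi_hom: "\<phi> \<in> bdd_lattice_hom B (i_filter_lattice D)"
begin

abbreviation neg :: "'b \<Rightarrow> 'b"  ("\<ominus> _" [81] 80)
  where "\<ominus> a \<equiv> bcompl B a"

lemma phi_filter: "a \<in> carrier B \<Longrightarrow> i_filter D (\<phi> a)"
  using phi_hom by (auto simp: bdd_lattice_hom_def i_filter_lattice_def)

lemma phi_carrier: "\<lbrakk>x \<in> \<phi> a; a \<in> carrier B\<rbrakk> \<Longrightarrow> x \<in> carrier D"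
  using phi_filter D.i_filter_in_carrier by blast

lemma phi_bot: "\<phi> (lbot B) = {rtop D}"
  and phi_top: "\<phi> (ltop B) = carrier D"
  and phi_meet: "\<lbrakk>a \<in> carrier B; b \<in> carrier B\<rbrakk> \<Longrightarrow> \<phi> (a \<curlywedge>\<^bsub>B\<^esub> b) = \<phi> a \<inter> \<phi> b"
  and phi_join: "\<lbrakk>a \<in> carrier B; b \<in> carrier B\<rbrakk>
                  \<Longrightarrow> \<phi> (a \<curlyvee>\<^bsub>B\<^esub> b) = \<phi> a \<curlyvee>\<^bsub>i_filter_lattice D\<^esub> \<phi> b"
  using phi_hom by (auto simp: bdd_lattice_hom_def i_filter_lattice_def)

lemma phi_mono: "\<lbrakk>a \<preceq>\<^bsub>B\<^esub> b; a \<in> carrier B; b \<in> carrier B\<rbrakk> \<Longrightarrow> \<phi> a \<subseteq> \<phi> b"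
  by (metis inf_le2 lattice_le_def phi_meet)

lemma phi_neg_Int: "a \<in> carrier B \<Longrightarrow> \<phi> a \<inter> \<phi> (\<ominus> a) = {rtop D}"
  by (metis B.bcompl_closed B.meet_bcompl phi_bot phi_meet)

lemma rtop_in_phi: "a \<in> carrier B \<Longrightarrow> rtop D \<in> \<phi> a"
  using phi_filter by (simp add: i_filter_def)

lemmas B_closed = B.meet_closed B.join_closed B.bcompl_closed B.lbot_closed B.ltop_closed

text \<open>
  The filters \<open>\<phi> a\<close> and \<open>\<phi> (\<ominus> a)\<close> meet in the unit and generate \<open>D\<close>, so \<open>D\<close> is their direct
  product; \<open>proj a\<close> is the projection onto \<open>\<phi> a\<close>. For the triple of a Stonean residuated
  lattice it is \<open>x \<mapsto> x \<or> \<not>a\<close>.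
\<close>

definition proj :: "'b \<Rightarrow> 'd \<Rightarrow> 'd"
  where "proj a x = (THE z. z \<in> \<phi> a \<and> D.filter_cong (\<phi> (\<ominus> a)) z x)"

text \<open>\<open>z\<close> and \<open>z'\<close> are congruent modulo
  \<open>\<phi> (\<ominus> a)\<close> through \<open>x\<close>, and modulo \<open>\<phi> a\<close>
  because both lie in it. The two filters share only the unit, so both implications are the
  unit.\<close>

lemma proj_unique:
  assumes a: "a \<in> carrier B" and x: "x \<in> carrier D"
    and z: "z \<in> \<phi> a" "D.filter_cong (\<phi> (\<ominus> a)) z x"
    and z': "z' \<in> \<phi> a" "D.filter_cong (\<phi> (\<ominus> a)) z' x"
  shows "z = z'"
proof -
  have F: "i_filter D (\<phi> a)" "i_filter D (\<phi> (\<ominus> a))"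
    using a by (simp_all add: phi_filter B_closed)
  have cl: "z \<in> carrier D" "z' \<in> carrier D"
    using a z z' phi_carrier by auto
  have "D.filter_cong (\<phi> (\<ominus> a)) z z'"
    by (rule D.filter_cong_trans[OF F(2) z(2) D.filter_cong_sym[OF z'(2)] cl(1) x cl(2)])
  moreover have "D.filter_cong (\<phi> a) z z'"
    using D.i_filter_rimp[OF F(1)] z z' cl by (auto simp: D.filter_cong_def)
  ultimately have "z \<leadsto>\<^bsub>D\<^esub> z' = rtop D" "z' \<leadsto>\<^bsub>D\<^esub> z = rtop D"
    using phi_neg_Int[OF a] by (auto simp: D.filter_cong_def)
  then show ?thesis
    using cl by (intro D.le_antisym) (simp_all add: D.rimp_eq_rtop_iff)
qed

text \<open>The two filters generate \<open>D\<close>, so some \<open>u \<star> v\<close> lies below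
  \<open>x\<close>. The witness is \<open>v \<leadsto> x\<close>: it lies above \<open>u\<close>,
  and its implication to \<open>x\<close> lies above \<open>v\<close>.\<close>

lemma proj_exists:
  assumes a: "a \<in> carrier B" and x: "x \<in> carrier D"
  obtains z where "z \<in> \<phi> a" "D.filter_cong (\<phi> (\<ominus> a)) z x"
proof -
  have F: "i_filter D (\<phi> a)" "i_filter D (\<phi> (\<ominus> a))"
    using a by (simp_all add: phi_filter B_closed)
  have "x \<in> \<phi> a \<curlyvee>\<^bsub>i_filter_lattice D\<^esub> \<phi> (\<ominus> a)"
    using a x by (simp add: B_closed B.join_bcompl phi_top flip: phi_join)
  then obtain u v where u: "u \<in> \<phi> a" and v: "v \<in> \<phi> (\<ominus> a)" and uv: "u \<star>\<^bsub>D\<^esub> v \<preceq>\<^bsub>D\<^esub> x"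
    using D.in_i_filter_join_iff[OF F] by blast
  have uv_cl: "u \<in> carrier D" "v \<in> carrier D"
    using u v F D.i_filter_in_carrier by blast+
  with x have cl: "u \<in> carrier D" "v \<in> carrier D" "v \<leadsto>\<^bsub>D\<^esub> x \<in> carrier D"
    by (simp_all add: D.closed)
  have "u \<preceq>\<^bsub>D\<^esub> v \<leadsto>\<^bsub>D\<^esub> x"
    using uv cl x by (simp add: D.residuation)
  then have 1: "v \<leadsto>\<^bsub>D\<^esub> x \<in> \<phi> a"
    using D.i_filter_up[OF F(1) u] cl by simp
  have "(v \<leadsto>\<^bsub>D\<^esub> x) \<star>\<^bsub>D\<^esub> v \<preceq>\<^bsub>D\<^esub> x"
    using cl x by (simp add: D.rimp_mult_le)
  then have "v \<preceq>\<^bsub>D\<^esub> (v \<leadsto>\<^bsub>D\<^esub> x) \<leadsto>\<^bsub>D\<^esub> x"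
    using cl x by (simp add: D.rmult_comm flip: D.residuation)
  then have "(v \<leadsto>\<^bsub>D\<^esub> x) \<leadsto>\<^bsub>D\<^esub> x \<in> \<phi> (\<ominus> a)"
    using D.i_filter_up[OF F(2) v] cl x D.closed by simp
  moreover have "x \<leadsto>\<^bsub>D\<^esub> (v \<leadsto>\<^bsub>D\<^esub> x) = rtop D"
    using cl x by (simp add: D.rimp_eq_rtop_iff D.le_rimp)
  ultimately have "D.filter_cong (\<phi> (\<ominus> a)) (v \<leadsto>\<^bsub>D\<^esub> x) x"
    using a by (simp add: D.filter_cong_def rtop_in_phi B_closed)
  with 1 show thesis by (rule that)
qed

lemma proj_eqI:
  assumes "a \<in> carrier B" "x \<in> carrier D" "z \<in> \<phi> a" "D.filter_cong (\<phi> (\<ominus> a)) z x"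
  shows "proj a x = z"
  unfolding proj_def using assms by (blast intro: the_equality proj_unique)

lemma
  assumes "a \<in> carrier B" "x \<in> carrier D"
  shows proj_in_phi: "proj a x \<in> \<phi> a"
    and proj_cong: "D.filter_cong (\<phi> (\<ominus> a)) (proj a x) x"
    and proj_closed: "proj a x \<in> carrier D"
proof -
  obtain z where z: "z \<in> \<phi> a" "D.filter_cong (\<phi> (\<ominus> a)) z x"
    using proj_exists[OF assms] .
  then show "proj a x \<in> \<phi> a" "D.filter_cong (\<phi> (\<ominus> a)) (proj a x) x"
    using proj_eqI[OF assms z] by auto
  then show "proj a x \<in> carrier D"
    using assms phi_carrier by blast
qed

section \<open>The projections as closure operators and endomorphisms\<close>

lemmas cl = B_closed D.closed proj_closed

text \<open>The implication from \<open>x\<close> to its projection lies in \<open>\<phi> a\<close>,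
  as its conclusion does, and in \<open>\<phi> (\<ominus> a)\<close> by congruence; so it is the
  unit.\<close>

lemma le_proj:
  assumes "a \<in> carrier B" "x \<in> carrier D" shows "x \<preceq>\<^bsub>D\<^esub> proj a x"
proof -
  have "x \<leadsto>\<^bsub>D\<^esub> proj a x \<in> \<phi> a"
    using assms by (simp add: D.i_filter_rimp phi_filter proj_in_phi)
  moreover have "x \<leadsto>\<^bsub>D\<^esub> proj a x \<in> \<phi> (\<ominus> a)"
    using proj_cong[OF assms] by (simp add: D.filter_cong_def)
  ultimately have "x \<leadsto>\<^bsub>D\<^esub> proj a x = rtop D"
    using phi_neg_Int assms by auto
  then show ?thesis
    using assms by (simp add: D.rimp_eq_rtop_iff cl)
qed

lemma proj_id: "\<lbrakk>a \<in> carrier B; x \<in> \<phi> a\<rbrakk> \<Longrightarrow> proj a x = x"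
  by (intro proj_eqI D.filter_cong_refl phi_filter) (auto simp: cl phi_carrier)

lemma proj_rtop: "a \<in> carrier B \<Longrightarrow> proj a (rtop D) = rtop D"
  by (simp add: proj_id rtop_in_phi)

lemma proj_top: "x \<in> carrier D \<Longrightarrow> proj (ltop B) x = x"
  by (simp add: proj_id phi_top cl)

lemma proj_bot: "x \<in> carrier D \<Longrightarrow> proj (lbot B) x = rtop D"
  using proj_in_phi[of "lbot B" x] by (simp add: phi_bot cl)

text \<open>Since \<open>rtop D \<leadsto> x\<close> is \<open>x\<close>, congruence to the unit
  modulo \<open>\<phi> (\<ominus> a)\<close> means membership in that filter.\<close>

lemma proj_eq_rtop_iff:
  assumes "a \<in> carrier B" "x \<in> carrier D"
  shows "proj a x = rtop D \<longleftrightarrow> x \<in> \<phi> (\<ominus> a)"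
proof
  assume "proj a x = rtop D"
  then show "x \<in> \<phi> (\<ominus> a)"
    using proj_cong[OF assms] D.rtop_rimp[OF assms(2)] by (simp add: D.filter_cong_def)
next
  assume "x \<in> \<phi> (\<ominus> a)"
  then show "proj a x = rtop D"
    using assms D.rtop_rimp[OF assms(2)]
    by (intro proj_eqI) (simp_all add: D.filter_cong_def rtop_in_phi cl D.i_filter_rimp phi_filter)
qed

text \<open>Each right-hand side lies in \<open>\<phi> a\<close>, by closure of i-filters, and is
  congruent to the argument on the left, by compatibility; these two properties characterise the
  projection.\<close>

lemma
  assumes a: "a \<in> carrier B" and x: "x \<in> carrier D" and y: "y \<in> carrier D"
  shows proj_rmult: "proj a (x \<star>\<^bsub>D\<^esub> y) = proj a x \<star>\<^bsub>D\<^esub> proj a y"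
    and proj_meet: "proj a (x \<curlywedge>\<^bsub>D\<^esub> y) = proj a x \<curlywedge>\<^bsub>D\<^esub> proj a y"
    and proj_rimp: "proj a (x \<leadsto>\<^bsub>D\<^esub> y) = proj a x \<leadsto>\<^bsub>D\<^esub> proj a y"
  using D.filter_cong_compat[OF phi_filter[OF B.bcompl_closed[OF a]] proj_cong[OF a x]
      proj_cong[OF a y]] assms
  by (auto intro!: proj_eqI D.i_filter_rmult D.i_filter_meet D.i_filter_rimp
      D.i_filter_carrier phi_filter proj_in_phi simp: cl)

lemma proj_mono:
  assumes "x \<preceq>\<^bsub>D\<^esub> y" "a \<in> carrier B" "x \<in> carrier D" "y \<in> carrier D"
  shows "proj a x \<preceq>\<^bsub>D\<^esub> proj a y"
  using assms by (metis lattice_le_def proj_meet)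

text \<open>Projecting goes upwards, so the second projection stays in \<open>\<phi> b\<close> and
  lands in \<open>\<phi> a \<inter> \<phi> b\<close>. The congruences of both steps hold modulo the
  larger filter \<open>\<phi> (\<ominus> (a \<curlywedge> b))\<close>, where they compose.\<close>

lemma proj_proj:
  assumes ab: "a \<in> carrier B" "b \<in> carrier B" and x: "x \<in> carrier D"
  shows "proj a (proj b x) = proj (a \<curlywedge>\<^bsub>B\<^esub> b) x"
proof (rule sym, rule proj_eqI)
  let ?F = "\<phi> (\<ominus> (a \<curlywedge>\<^bsub>B\<^esub> b))"
  have F: "i_filter D ?F"
    using ab by (simp add: phi_filter cl)
  have "proj a (proj b x) \<in> \<phi> b"
    using ab x by (intro D.i_filter_up[OF phi_filter proj_in_phi le_proj]) (simp_all add: cl)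
  then show "proj a (proj b x) \<in> \<phi> (a \<curlywedge>\<^bsub>B\<^esub> b)"
    using ab x by (simp add: phi_meet proj_in_phi cl)
  have "\<phi> (\<ominus> a) \<subseteq> ?F" "\<phi> (\<ominus> b) \<subseteq> ?F"
    using ab by (simp_all add: phi_mono B.bcompl_antimono B.meet_le1 B.meet_le2 cl)
  then have "D.filter_cong ?F (proj a (proj b x)) (proj b x)" "D.filter_cong ?F (proj b x) x"
    using ab x by (auto intro: D.filter_cong_mono[OF proj_cong] simp: cl)
  then show "D.filter_cong ?F (proj a (proj b x)) x"
    using ab x by (auto intro: D.filter_cong_trans[OF F] simp: cl)
qed (use assms in \<open>simp_all add: cl\<close>)

lemma proj_antimono:
  assumes "a \<preceq>\<^bsub>B\<^esub> b" "a \<in> carrier B" "b \<in> carrier B" "x \<in> carrier D"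
  shows "proj b x \<preceq>\<^bsub>D\<^esub> proj a x"
  using le_proj[of a "proj b x"] assms by (simp add: proj_proj cl lattice_le_def[of B])

text \<open>The usual law of a closure operator; it removes the projection from the left when second
  components are compared.\<close>

lemma proj_le_proj_iff:
  assumes "a \<in> carrier B" "x \<in> carrier D" "y \<in> carrier D"
  shows "proj a x \<preceq>\<^bsub>D\<^esub> proj a y \<longleftrightarrow> x \<preceq>\<^bsub>D\<^esub> proj a y"
proof
  assume "proj a x \<preceq>\<^bsub>D\<^esub> proj a y"
  then show "x \<preceq>\<^bsub>D\<^esub> proj a y"
    using D.le_trans[OF le_proj[OF assms(1,2)]] assms by (simp add: cl)
next
  assume "x \<preceq>\<^bsub>D\<^esub> proj a y"
  then have "proj a x \<preceq>\<^bsub>D\<^esub> proj a (proj a y)"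
    using assms by (simp add: proj_mono cl)
  then show "proj a x \<preceq>\<^bsub>D\<^esub> proj a y"
    using assms by (simp add: proj_id proj_in_phi)
qed

lemma phi_subset_join:
  assumes "a \<in> carrier B" "b \<in> carrier B"
  shows "\<phi> a \<subseteq> \<phi> (a \<curlyvee>\<^bsub>B\<^esub> b)" "\<phi> b \<subseteq> \<phi> (a \<curlyvee>\<^bsub>B\<^esub> b)"
  using assms by (simp_all add: phi_mono B.le_join1 B.le_join2 cl)

text \<open>The meet \<open>?z\<close> lies above \<open>x\<close>, so only
  \<open>?z \<leadsto> x\<close> is at issue. It lies above \<open>proj a x \<leadsto> x\<close> and
  \<open>proj b x \<leadsto> x\<close>, hence in both \<open>\<phi> (\<ominus> a)\<close> and
  \<open>\<phi> (\<ominus> b)\<close>, and De Morgan concludes.\<close>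

lemma proj_join_index:
  assumes ab: "a \<in> carrier B" "b \<in> carrier B" and x: "x \<in> carrier D"
  shows "proj (a \<curlyvee>\<^bsub>B\<^esub> b) x = proj a x \<curlywedge>\<^bsub>D\<^esub> proj b x"
proof (rule proj_eqI)
  let ?z = "proj a x \<curlywedge>\<^bsub>D\<^esub> proj b x"
  show "?z \<in> \<phi> (a \<curlyvee>\<^bsub>B\<^esub> b)"
    using ab x proj_in_phi phi_subset_join[OF ab] by (intro D.i_filter_meet phi_filter) (auto simp: cl)
  have le: "\<phi> (\<ominus> a) \<inter> \<phi> (\<ominus> b) \<subseteq> \<phi> (\<ominus> (a \<curlyvee>\<^bsub>B\<^esub> b))"
    using ab phi_mono[OF B.bcompl_meet_le] by (simp add: cl phi_meet)
  have "?z \<leadsto>\<^bsub>D\<^esub> x \<in> \<phi> (\<ominus> a)"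
    using proj_cong[OF ab(1) x] ab x unfolding D.filter_cong_def
    by (intro D.i_filter_up[OF phi_filter _ D.rimp_mono[OF D.meet_le1 D.le_refl]])
      (auto simp: cl)
  moreover have "?z \<leadsto>\<^bsub>D\<^esub> x \<in> \<phi> (\<ominus> b)"
    using proj_cong[OF ab(2) x] ab x unfolding D.filter_cong_def
    by (intro D.i_filter_up[OF phi_filter _ D.rimp_mono[OF D.meet_le2 D.le_refl]])
      (auto simp: cl)
  moreover have "x \<leadsto>\<^bsub>D\<^esub> ?z = rtop D"
    using ab x by (simp add: D.rimp_eq_rtop_iff D.le_meetI le_proj cl)
  ultimately show "D.filter_cong (\<phi> (\<ominus> (a \<curlyvee>\<^bsub>B\<^esub> b))) ?z x"
    using le ab by (auto simp: D.filter_cong_def rtop_in_phi cl)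
qed (use assms in \<open>simp_all add: cl\<close>)

text \<open>The direct product decomposition: an element is recovered from its components over
  \<open>a\<close> and over the complement of \<open>a\<close>.\<close>

lemma proj_split:
  assumes "a \<in> carrier B" "x \<in> carrier D"
  shows "proj a x \<curlywedge>\<^bsub>D\<^esub> proj (\<ominus> a) x = x"
  using proj_join_index[of a "\<ominus> a" x] assms by (simp add: B.join_bcompl proj_top cl)

text \<open>
  The elements of the glued lattice are the pairs \<open>(a, x)\<close> with \<open>x \<in> \<phi> a\<close>, standing for \<open>a \<and> x\<close>;
  \<open>x\<close> is the canonical representative of its class in \<open>D\<close> modulo \<open>\<phi> (\<ominus> a)\<close>, and is wrapped as a
  singleton to have the type of such a class.
\<close>

definition glued :: "('b \<times> 'd set) bdd_res_lattice"
  where "glued =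
    \<lparr>carrier = {(a, {x}) | a x. a \<in> carrier B \<and> x \<in> \<phi> a},
     join_op = (\<lambda>(a, X) (b, Y). (a \<curlyvee>\<^bsub>B\<^esub> b,
       {proj (a \<curlywedge>\<^bsub>B\<^esub> b) (the_elem X \<curlyvee>\<^bsub>D\<^esub> the_elem Y) \<curlywedge>\<^bsub>D\<^esub>
        (proj (\<ominus> b) (the_elem X) \<curlywedge>\<^bsub>D\<^esub> proj (\<ominus> a) (the_elem Y))})),
     meet_op = (\<lambda>(a, X) (b, Y). (a \<curlywedge>\<^bsub>B\<^esub> b, {proj (a \<curlywedge>\<^bsub>B\<^esub> b) (the_elem X \<curlywedge>\<^bsub>D\<^esub> the_elem Y)})),
     rmult = (\<lambda>(a, X) (b, Y). (a \<curlywedge>\<^bsub>B\<^esub> b, {proj (a \<curlywedge>\<^bsub>B\<^esub> b) (the_elem X \<star>\<^bsub>D\<^esub> the_elem Y)})),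
     rimp = (\<lambda>(a, X) (b, Y). (\<ominus> a \<curlyvee>\<^bsub>B\<^esub> b, {proj (a \<curlywedge>\<^bsub>B\<^esub> b) (the_elem X \<leadsto>\<^bsub>D\<^esub> the_elem Y)})),
     rtop = (ltop B, {rtop D}),
     rbot = (lbot B, {rtop D})\<rparr>"

text \<open>The second component of \<open>q\<close> is projected to the index of \<open>p\<close>,
  so that both are compared over the same Boolean element.\<close>

definition glued_le :: "'b \<times> 'd set \<Rightarrow> 'b \<times> 'd set \<Rightarrow> bool"
  where "glued_le p q \<longleftrightarrow>
    fst p \<preceq>\<^bsub>B\<^esub> fst q \<and> the_elem (snd p) \<preceq>\<^bsub>D\<^esub> proj (fst p) (the_elem (snd q))"

lemma glued_le_pair: "glued_le (a, {x}) (b, {y}) \<longleftrightarrow> a \<preceq>\<^bsub>B\<^esub> b \<and> x \<preceq>\<^bsub>D\<^esub> proj a y"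
  by (simp add: glued_le_def)

lemma glued_carrier_pair: "(a, {x}) \<in> carrier glued \<longleftrightarrow> a \<in> carrier B \<and> x \<in> \<phi> a"
  by (simp add: glued_def)

lemma glued_cases:
  assumes "p \<in> carrier glued"
  obtains a x where "p = (a, {x})" "a \<in> carrier B" "x \<in> \<phi> a" "x \<in> carrier D"
  using assms phi_carrier by (auto simp: glued_def)

text \<open>The join is assembled over three disjoint pieces: its component is the join of
  \<open>x\<close> and \<open>y\<close> over \<open>a \<curlywedge> b\<close>, \<open>x\<close> over
  \<open>a \<curlywedge> \<ominus> b\<close>, and \<open>y\<close> over
  \<open>b \<curlywedge> \<ominus> a\<close>; by \<open>proj_join_index\<close> components over
  pieces are combined by meet. For the implication only the piece \<open>a \<curlywedge> b\<close>
  contributes, the component being the unit elsewhere.\<close>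

lemma glued_ops:
  shows "(a, {x}) \<curlyvee>\<^bsub>glued\<^esub> (b, {y}) = (a \<curlyvee>\<^bsub>B\<^esub> b,
      {proj (a \<curlywedge>\<^bsub>B\<^esub> b) (x \<curlyvee>\<^bsub>D\<^esub> y) \<curlywedge>\<^bsub>D\<^esub> (proj (\<ominus> b) x \<curlywedge>\<^bsub>D\<^esub> proj (\<ominus> a) y)})"
    and "(a, {x}) \<curlywedge>\<^bsub>glued\<^esub> (b, {y}) = (a \<curlywedge>\<^bsub>B\<^esub> b, {proj (a \<curlywedge>\<^bsub>B\<^esub> b) (x \<curlywedge>\<^bsub>D\<^esub> y)})"
    and "(a, {x}) \<star>\<^bsub>glued\<^esub> (b, {y}) = (a \<curlywedge>\<^bsub>B\<^esub> b, {proj (a \<curlywedge>\<^bsub>B\<^esub> b) (x \<star>\<^bsub>D\<^esub> y)})"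
    and "(a, {x}) \<leadsto>\<^bsub>glued\<^esub> (b, {y}) = (\<ominus> a \<curlyvee>\<^bsub>B\<^esub> b, {proj (a \<curlywedge>\<^bsub>B\<^esub> b) (x \<leadsto>\<^bsub>D\<^esub> y)})"
    and "rtop glued = (ltop B, {rtop D})"
    and "rbot glued = (lbot B, {rtop D})"
  by (simp_all add: glued_def)

section \<open>Closure, order and residuation of the glued operations\<close>

lemma proj_stays:
  assumes "a \<in> carrier B" "b \<in> carrier B" "x \<in> \<phi> b"
  shows "proj a x \<in> \<phi> b"
  using assms phi_carrier by (auto intro!: D.i_filter_up[OF phi_filter _ le_proj] simp: cl)

lemma glued_closed:
  assumes "p \<in> carrier glued" "q \<in> carrier glued"
  shows "p \<curlyvee>\<^bsub>glued\<^esub> q \<in> carrier glued" "p \<curlywedge>\<^bsub>glued\<^esub> q \<in> carrier glued"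
    "p \<star>\<^bsub>glued\<^esub> q \<in> carrier glued" "p \<leadsto>\<^bsub>glued\<^esub> q \<in> carrier glued"
proof -
  obtain a x where p: "p = (a, {x})" "a \<in> carrier B" "x \<in> \<phi> a" "x \<in> carrier D"
    using assms glued_cases by blast
  obtain b y where q: "q = (b, {y})" "b \<in> carrier B" "y \<in> \<phi> b" "y \<in> carrier D"
    using assms glued_cases by blast
  have sub: "\<phi> (a \<curlywedge>\<^bsub>B\<^esub> b) \<subseteq> \<phi> (a \<curlyvee>\<^bsub>B\<^esub> b)" "\<phi> (a \<curlywedge>\<^bsub>B\<^esub> b) \<subseteq> \<phi> (\<ominus> a \<curlyvee>\<^bsub>B\<^esub> b)"
    using p q phi_subset_join[of a b] phi_subset_join[of "\<ominus> a" b] by (auto simp: phi_meet cl)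
  have "proj (\<ominus> b) x \<in> \<phi> (a \<curlyvee>\<^bsub>B\<^esub> b)" "proj (\<ominus> a) y \<in> \<phi> (a \<curlyvee>\<^bsub>B\<^esub> b)"
    using p q phi_subset_join[of a b] by (auto intro!: proj_stays simp: cl)
  moreover have "proj (a \<curlywedge>\<^bsub>B\<^esub> b) (x \<curlyvee>\<^bsub>D\<^esub> y) \<in> \<phi> (a \<curlyvee>\<^bsub>B\<^esub> b)"
    using p q sub(1) proj_in_phi[of "a \<curlywedge>\<^bsub>B\<^esub> b" "x \<curlyvee>\<^bsub>D\<^esub> y"] by (auto simp: cl)
  ultimately show "p \<curlyvee>\<^bsub>glued\<^esub> q \<in> carrier glued"
    using p q by (simp add: glued_ops glued_carrier_pair cl D.i_filter_meet phi_filter)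
  show "p \<curlywedge>\<^bsub>glued\<^esub> q \<in> carrier glued" "p \<star>\<^bsub>glued\<^esub> q \<in> carrier glued"
    using p q by (simp_all add: glued_ops glued_carrier_pair proj_in_phi cl)
  show "p \<leadsto>\<^bsub>glued\<^esub> q \<in> carrier glued"
    using p q sub(2) proj_in_phi[of "a \<curlywedge>\<^bsub>B\<^esub> b" "x \<leadsto>\<^bsub>D\<^esub> y"]
    by (auto simp: glued_ops glued_carrier_pair cl)
qed

lemma proj_proj_le:
  assumes "a \<preceq>\<^bsub>B\<^esub> b" "a \<in> carrier B" "b \<in> carrier B" "x \<in> carrier D"
  shows "proj a (proj b x) = proj a x"
  using assms by (simp add: proj_proj lattice_le_def)

lemma
  assumes a: "a \<in> carrier B" "x \<in> \<phi> a" "x \<in> carrier D"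
    and b: "b \<in> carrier B" "y \<in> \<phi> b" "y \<in> carrier D"
    and c: "c \<in> carrier B" "z \<in> \<phi> c" "z \<in> carrier D"
  shows glued_le_trans: "\<lbrakk>glued_le (a, {x}) (b, {y}); glued_le (b, {y}) (c, {z})\<rbrakk>
      \<Longrightarrow> glued_le (a, {x}) (c, {z})"
    and glued_le_meetI: "\<lbrakk>glued_le (c, {z}) (a, {x}); glued_le (c, {z}) (b, {y})\<rbrakk>
      \<Longrightarrow> glued_le (c, {z}) ((a, {x}) \<curlywedge>\<^bsub>glued\<^esub> (b, {y}))"
    and glued_join_leI: "\<lbrakk>glued_le (a, {x}) (c, {z}); glued_le (b, {y}) (c, {z})\<rbrakk>
      \<Longrightarrow> glued_le ((a, {x}) \<curlyvee>\<^bsub>glued\<^esub> (b, {y})) (c, {z})"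
    and glued_residuation: "glued_le ((a, {x}) \<star>\<^bsub>glued\<^esub> (b, {y})) (c, {z}) \<longleftrightarrow>
      glued_le (a, {x}) ((b, {y}) \<leadsto>\<^bsub>glued\<^esub> (c, {z}))"
proof -
  note mem = a(1,3) b(1,3) c(1,3)
  show "glued_le (a, {x}) (c, {z})"
    if 1: "glued_le (a, {x}) (b, {y})" and 2: "glued_le (b, {y}) (c, {z})"
  proof -
    have le: "a \<preceq>\<^bsub>B\<^esub> b" "b \<preceq>\<^bsub>B\<^esub> c" "x \<preceq>\<^bsub>D\<^esub> proj a y" "y \<preceq>\<^bsub>D\<^esub> proj b z"
      using 1 2 by (auto simp: glued_le_pair)
    have "proj a y \<preceq>\<^bsub>D\<^esub> proj a z"
      using proj_mono[OF le(4) a(1)] le(1) mem by (simp add: proj_proj_le cl)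
    then have "x \<preceq>\<^bsub>D\<^esub> proj a z"
      using mem by (intro D.le_trans[OF le(3)]) (simp_all add: cl)
    moreover have "a \<preceq>\<^bsub>B\<^esub> c"
      using B.le_trans[OF le(1,2)] mem by simp
    ultimately show ?thesis
      by (simp add: glued_le_pair)
  qed
  show "glued_le (c, {z}) ((a, {x}) \<curlywedge>\<^bsub>glued\<^esub> (b, {y}))"
    if 1: "glued_le (c, {z}) (a, {x})" and 2: "glued_le (c, {z}) (b, {y})"
  proof -
    have "c \<preceq>\<^bsub>B\<^esub> a \<curlywedge>\<^bsub>B\<^esub> b"
      using 1 2 mem by (simp add: glued_le_pair B.le_meetI)
    then show ?thesis
      using 1 2 mem by (simp add: glued_le_pair glued_ops proj_proj_le proj_meet D.le_meetI cl)
  qed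
  show "glued_le ((a, {x}) \<curlyvee>\<^bsub>glued\<^esub> (b, {y})) (c, {z})"
    if 1: "glued_le (a, {x}) (c, {z})" and 2: "glued_le (b, {y}) (c, {z})"
  proof -
    \<comment> \<open>The components of the join over the three pieces. Those of \<open>?u\<close>
      and \<open>?v\<close> make up \<open>a\<close>, those of \<open>?u\<close> and
      \<open>?w\<close> make up \<open>b\<close>.\<close>
    let ?u = "proj (a \<curlywedge>\<^bsub>B\<^esub> b) (x \<curlyvee>\<^bsub>D\<^esub> y)" and ?v = "proj (\<ominus> b) x" and ?w = "proj (\<ominus> a) y"
    have x: "x \<preceq>\<^bsub>D\<^esub> proj a z" and y: "y \<preceq>\<^bsub>D\<^esub> proj b z"
      using 1 2 by (simp_all add: glued_le_pair)
    have pc: "?u \<in> carrier D" "?v \<in> carrier D" "?w \<in> carrier D"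
      using mem by (simp_all add: cl)
    have "x \<preceq>\<^bsub>D\<^esub> proj (a \<curlywedge>\<^bsub>B\<^esub> b) z" "y \<preceq>\<^bsub>D\<^esub> proj (a \<curlywedge>\<^bsub>B\<^esub> b) z"
      using mem by (auto intro!: D.le_trans[OF x] D.le_trans[OF y] proj_antimono B.meet_le1
          B.meet_le2 simp: cl)
    then have "x \<curlyvee>\<^bsub>D\<^esub> y \<preceq>\<^bsub>D\<^esub> proj (a \<curlywedge>\<^bsub>B\<^esub> b) z"
      using mem by (simp add: D.join_leI cl)
    then have u: "?u \<preceq>\<^bsub>D\<^esub> proj (a \<curlywedge>\<^bsub>B\<^esub> b) z"
      using mem by (simp add: proj_le_proj_iff cl)
    have v: "?v \<preceq>\<^bsub>D\<^esub> proj (\<ominus> b) (proj a z)" and w: "?w \<preceq>\<^bsub>D\<^esub> proj (\<ominus> a) (proj b z)"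
      using mem by (auto intro!: proj_mono x y simp: cl)
    \<comment> \<open>\<open>proj_split\<close> at index \<open>b\<close> reassembles
      \<open>proj a z\<close> from its parts over \<open>a \<curlywedge> b\<close> and
      \<open>a \<curlywedge> \<ominus> b\<close>.\<close>
    have "?u \<curlywedge>\<^bsub>D\<^esub> ?v \<preceq>\<^bsub>D\<^esub> proj b (proj a z) \<curlywedge>\<^bsub>D\<^esub> proj (\<ominus> b) (proj a z)"
      using u v mem by (intro D.meet_mono) (simp_all add: proj_proj B.meet_comm cl)
    then have uv: "?u \<curlywedge>\<^bsub>D\<^esub> ?v \<preceq>\<^bsub>D\<^esub> proj a z"
      using mem by (simp add: proj_split cl)
    have "?u \<curlywedge>\<^bsub>D\<^esub> ?w \<preceq>\<^bsub>D\<^esub> proj a (proj b z) \<curlywedge>\<^bsub>D\<^esub> proj (\<ominus> a) (proj b z)"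
      using u w mem by (intro D.meet_mono) (simp_all add: proj_proj cl)
    then have uw: "?u \<curlywedge>\<^bsub>D\<^esub> ?w \<preceq>\<^bsub>D\<^esub> proj b z"
      using mem by (simp add: proj_split cl)
    have "?u \<curlywedge>\<^bsub>D\<^esub> (?v \<curlywedge>\<^bsub>D\<^esub> ?w) \<preceq>\<^bsub>D\<^esub> ?u \<curlywedge>\<^bsub>D\<^esub> ?v" "?u \<curlywedge>\<^bsub>D\<^esub> (?v \<curlywedge>\<^bsub>D\<^esub> ?w) \<preceq>\<^bsub>D\<^esub> ?u \<curlywedge>\<^bsub>D\<^esub> ?w"
      by (intro D.meet_mono D.le_refl D.meet_le1 D.meet_le2 D.meet_closed pc)+
    then have "?u \<curlywedge>\<^bsub>D\<^esub> (?v \<curlywedge>\<^bsub>D\<^esub> ?w) \<preceq>\<^bsub>D\<^esub> proj a z" "?u \<curlywedge>\<^bsub>D\<^esub> (?v \<curlywedge>\<^bsub>D\<^esub> ?w) \<preceq>\<^bsub>D\<^esub> proj b z"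
      using mem pc by (auto elim!: D.le_trans[OF _ uv] D.le_trans[OF _ uw] simp: cl)
    then have "?u \<curlywedge>\<^bsub>D\<^esub> (?v \<curlywedge>\<^bsub>D\<^esub> ?w) \<preceq>\<^bsub>D\<^esub> proj (a \<curlyvee>\<^bsub>B\<^esub> b) z"
      using mem by (simp add: proj_join_index D.le_meetI cl)
    then show ?thesis
      using 1 2 mem by (simp add: glued_le_pair glued_ops B.join_leI)
  qed
  show "glued_le ((a, {x}) \<star>\<^bsub>glued\<^esub> (b, {y})) (c, {z}) \<longleftrightarrow>
      glued_le (a, {x}) ((b, {y}) \<leadsto>\<^bsub>glued\<^esub> (c, {z}))"
  \<comment> \<open>Boolean residuation makes the conditions on first components equivalent. If they
    fail, both sides are false; otherwise only second components remain.\<close>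
  proof (cases "a \<curlywedge>\<^bsub>B\<^esub> b \<preceq>\<^bsub>B\<^esub> c")
    case True
    let ?e = "a \<curlywedge>\<^bsub>B\<^esub> b"
    \<comment> \<open>As \<open>?e\<close> lies below \<open>c\<close>, both sides are compared over
      the same index \<open>?e\<close>, where the projection is an endomorphism and residuation in
      \<open>D\<close> applies.\<close>
    have "proj a (proj (b \<curlywedge>\<^bsub>B\<^esub> c) (y \<leadsto>\<^bsub>D\<^esub> z)) = proj ?e (y \<leadsto>\<^bsub>D\<^esub> z)"
      using mem True by (simp add: proj_proj lattice_le_def cl flip: B.meet_assoc)
    moreover have "proj ?e (x \<star>\<^bsub>D\<^esub> y) \<preceq>\<^bsub>D\<^esub> proj ?e z \<longleftrightarrow> x \<preceq>\<^bsub>D\<^esub> proj ?e (y \<leadsto>\<^bsub>D\<^esub> z)"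
      using mem proj_le_proj_iff[of ?e x "y \<leadsto>\<^bsub>D\<^esub> z"]
      by (simp add: proj_rmult proj_rimp D.residuation cl)
    ultimately show ?thesis
      using True mem by (simp add: glued_le_pair glued_ops B.meet_le_iff_le_bcompl_join)
  next
    case False
    then show ?thesis
      using mem by (simp add: glued_le_pair glued_ops B.meet_le_iff_le_bcompl_join)
  qed
qed

lemma
  assumes a: "a \<in> carrier B" "x \<in> \<phi> a" "x \<in> carrier D"
    and b: "b \<in> carrier B" "y \<in> \<phi> b" "y \<in> carrier D"
  shows glued_le_refl: "glued_le (a, {x}) (a, {x})"
    and glued_le_antisym: "\<lbrakk>glued_le (a, {x}) (b, {y}); glued_le (b, {y}) (a, {x})\<rbrakk>
      \<Longrightarrow> (a, {x}) = (b, {y})"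
    and glued_meet_le1: "glued_le ((a, {x}) \<curlywedge>\<^bsub>glued\<^esub> (b, {y})) (a, {x})"
    and glued_meet_le2: "glued_le ((a, {x}) \<curlywedge>\<^bsub>glued\<^esub> (b, {y})) (b, {y})"
    and glued_le_join1: "glued_le (a, {x}) ((a, {x}) \<curlyvee>\<^bsub>glued\<^esub> (b, {y}))"
    and glued_le_join2: "glued_le (b, {y}) ((a, {x}) \<curlyvee>\<^bsub>glued\<^esub> (b, {y}))"
proof -
  note mem = a(1,3) b(1,3)
  show "glued_le (a, {x}) (a, {x})"
    using a by (simp add: glued_le_pair B.le_refl D.le_refl proj_id)
  show "(a, {x}) = (b, {y})" if "glued_le (a, {x}) (b, {y})" "glued_le (b, {y}) (a, {x})"
  proof -
    have "a = b"
      using that mem by (auto simp: glued_le_pair intro: B.le_antisym)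
    then show ?thesis
      using that a b by (auto simp: glued_le_pair proj_id intro: D.le_antisym)
  qed
  show "glued_le ((a, {x}) \<curlywedge>\<^bsub>glued\<^esub> (b, {y})) (a, {x})"
    "glued_le ((a, {x}) \<curlywedge>\<^bsub>glued\<^esub> (b, {y})) (b, {y})"
    using mem by (simp_all add: glued_le_pair glued_ops B.meet_le1 B.meet_le2 proj_meet
        D.meet_le1 D.meet_le2 cl)
  have x: "x \<preceq>\<^bsub>D\<^esub> proj c x" and y: "y \<preceq>\<^bsub>D\<^esub> proj c y" if "c \<in> carrier B" for c
    using that mem by (simp_all add: le_proj)
  have xy: "x \<preceq>\<^bsub>D\<^esub> proj c (x \<curlyvee>\<^bsub>D\<^esub> y)" "y \<preceq>\<^bsub>D\<^esub> proj c (x \<curlyvee>\<^bsub>D\<^esub> y)" if "c \<in> carrier B" for c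
    using that mem by (auto intro!: D.le_trans[OF _ le_proj] D.le_join1 D.le_join2 simp: cl)
  \<comment> \<open>Projected to \<open>a\<close>, the factor \<open>proj (\<ominus> a) y\<close> of
    the join becomes a projection to bottom, which is the unit. The other two factors are
    projections of elements above \<open>x\<close>.\<close>
  show "glued_le (a, {x}) ((a, {x}) \<curlyvee>\<^bsub>glued\<^esub> (b, {y}))"
    using mem x xy
    by (simp add: glued_le_pair glued_ops B.le_join1 proj_meet proj_proj B.meet_bcompl proj_bot
        D.meet_rtop D.le_meetI cl)
  show "glued_le (b, {y}) ((a, {x}) \<curlyvee>\<^bsub>glued\<^esub> (b, {y}))"
    using mem y xy
    by (simp add: glued_le_pair glued_ops B.le_join2 proj_meet proj_proj B.meet_bcompl proj_bot
        D.rtop_meet D.le_meetI cl)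
qed

lemma glued_lattice: "alg_lattice glued"
  and glued_le_iff: "\<lbrakk>p \<in> carrier glued; q \<in> carrier glued\<rbrakk> \<Longrightarrow> p \<preceq>\<^bsub>glued\<^esub> q \<longleftrightarrow> glued_le p q"
proof -
  note * = glued_le_refl glued_le_trans glued_le_antisym glued_meet_le1 glued_meet_le2
    glued_le_meetI glued_le_join1 glued_le_join2 glued_join_leI
  show "alg_lattice glued"
    by (rule alg_lattice_of_order[where R = glued_le];
        ((rule glued_closed; assumption) | (elim glued_cases, hypsubst, (rule *; assumption))))
  show "p \<preceq>\<^bsub>glued\<^esub> q \<longleftrightarrow> glued_le p q" if "p \<in> carrier glued" "q \<in> carrier glued"
    by (rule alg_lattice_of_order(2)[where R = glued_le];
        (fact that | (rule glued_closed; assumption) |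
          (elim glued_cases, hypsubst, (rule *; assumption))))
qed

text \<open>Negation forgets the second component, because any implication into the unit is the
  unit. The Stonean identity thereby reduces to excluded middle in \<open>B\<close>.\<close>

lemma glued_neg:
  assumes "a \<in> carrier B" "x \<in> carrier D"
  shows "\<sim>\<^bsub>glued\<^esub> (a, {x}) = (\<ominus> a, {rtop D})"
  using assms
  by (simp add: rneg_def glued_ops proj_rimp D.rimp_eq_rtop_iff D.rtop_greatest cl proj_rtop
      B.join_comm[of _ "lbot B"] B.bot_join)

lemma glued_stonean: "stonean_residuated_lattice glued"
proof -
  have top: "rtop glued \<in> carrier glued" and bot: "rbot glued \<in> carrier glued"
    by (simp_all add: glued_ops glued_carrier_pair cl rtop_in_phi)
  show ?thesis
  proof (intro stonean_residuated_lattice.intro bounded_residuated_lattice.intro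
      residuated_lattice.intro residuated_lattice_axioms.intro
      bounded_residuated_lattice_axioms.intro stonean_residuated_lattice_axioms.intro)
    show "comm_monoid \<lparr>carrier = carrier glued, monoid.mult = rmult glued, one = rtop glued\<rparr>"
    proof (rule comm_monoidI; simp)
      fix p q r assume "p \<in> carrier glued" "q \<in> carrier glued" "r \<in> carrier glued"
      \<comment> \<open>Projections are multiplicative and compose by meeting their indices, so both
        sides become the product of the three second components projected to the meet of the three
        indices.\<close>
      then show "p \<star>\<^bsub>glued\<^esub> q \<star>\<^bsub>glued\<^esub> r = p \<star>\<^bsub>glued\<^esub> (q \<star>\<^bsub>glued\<^esub> r)"
        by (elim glued_cases)
          (simp add: glued_ops proj_rmult proj_proj cl B.meet_aci D.rmult_assoc)
    next
      fix p q assume "p \<in> carrier glued" "q \<in> carrier glued"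
      then show "p \<star>\<^bsub>glued\<^esub> q = q \<star>\<^bsub>glued\<^esub> p"
        by (elim glued_cases) (simp add: glued_ops B.meet_comm D.rmult_comm)
    next
      fix p assume "p \<in> carrier glued"
      then show "rtop glued \<star>\<^bsub>glued\<^esub> p = p"
        by (elim glued_cases) (simp add: glued_ops B.meet_comm[of "ltop B"] B.meet_top cl
            D.rmult_comm[of "rtop D"] D.rmult_rtop proj_id)
    qed (simp_all add: glued_closed top)
    fix p q r assume "p \<in> carrier glued" "q \<in> carrier glued" "r \<in> carrier glued"
    moreover from this have "glued_le (p \<star>\<^bsub>glued\<^esub> q) r \<longleftrightarrow> glued_le p (q \<leadsto>\<^bsub>glued\<^esub> r)"
      by (elim glued_cases) (simp add: glued_residuation)
    ultimately show "p \<star>\<^bsub>glued\<^esub> q \<preceq>\<^bsub>glued\<^esub> r \<longleftrightarrow> p \<preceq>\<^bsub>glued\<^esub> (q \<leadsto>\<^bsub>glued\<^esub> r)"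
      by (simp add: glued_le_iff glued_closed)
  next
    fix p assume p: "p \<in> carrier glued"
    then have "glued_le p (rtop glued)" "glued_le (rbot glued) p"
      by (auto elim!: glued_cases simp: glued_le_pair glued_ops B.ltop_greatest B.lbot_least
          proj_rtop proj_bot D.rtop_greatest D.le_refl cl)
    then show "p \<preceq>\<^bsub>glued\<^esub> rtop glued" "rbot glued \<preceq>\<^bsub>glued\<^esub> p"
      using p top bot by (simp_all add: glued_le_iff)
    show "\<sim>\<^bsub>glued\<^esub> p \<curlyvee>\<^bsub>glued\<^esub> \<sim>\<^bsub>glued\<^esub> (\<sim>\<^bsub>glued\<^esub> p) = rtop glued"
      using p by (elim glued_cases)
        (simp add: glued_neg cl glued_ops B.join_bcompl proj_rtop D.meet_rtop D.join_rtop)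
  qed (fact glued_lattice glued_closed bot)+
qed

section \<open>The triple of the glued lattice\<close>

lemma boolean_part_glued_carrier:
  "carrier (boolean_part glued) = (\<lambda>a. (a, {rtop D})) ` carrier B"
proof -
  \<comment> \<open>The join with the negation still records \<open>x\<close>, so it is the top
    exactly when \<open>x\<close> is the unit; the meet is bottom in every case.\<close>
  have "(a, {x}) \<curlyvee>\<^bsub>glued\<^esub> \<sim>\<^bsub>glued\<^esub> (a, {x}) = (ltop B, {x})"
    "(a, {x}) \<curlywedge>\<^bsub>glued\<^esub> \<sim>\<^bsub>glued\<^esub> (a, {x}) = rbot glued"
    if "a \<in> carrier B" "x \<in> \<phi> a" "x \<in> carrier D" for a x
    using that by (simp_all add: glued_neg glued_ops B.join_bcompl B.meet_bcompl B.bcompl_bcompl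
        proj_bot proj_rtop proj_id D.meet_rtop D.rtop_meet cl)
  then show ?thesis
    by (auto simp: boolean_part_def glued_carrier_pair glued_ops(5) rtop_in_phi cl
        elim!: glued_cases)
qed

text \<open>The negation is bottom exactly when the index is \<open>ltop B\<close>, and over that
  index the second component ranges over all of \<open>D\<close>.\<close>

lemma dense_part_glued_carrier:
  "carrier (dense_part glued) = (\<lambda>x. (ltop B, {x})) ` carrier D"
proof -
  have "\<ominus> a = lbot B \<longleftrightarrow> a = ltop B" if "a \<in> carrier B" for a
    using that B.bcompl_bcompl B.bcompl_bot B.bcompl_top by metis
  then show ?thesis
    by (auto simp: dense_part_def glued_carrier_pair glued_neg glued_ops(6) phi_top cl
        elim!: glued_cases)
qed

lemma boolean_part_glued_hom: "(\<lambda>a. (a, {rtop D})) \<in> boolean_hom B (boolean_part glued)"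
  unfolding boolean_hom_def bdd_lattice_hom_def boolean_part_glued_carrier
  by (auto simp: boolean_part_def glued_ops glued_neg proj_rtop D.join_rtop D.meet_rtop cl)

text \<open>Over \<open>ltop B\<close> projection is the identity, and the outer factors of the join
  are projections to bottom, hence the unit; what remains are the operations of
  \<open>D\<close>.\<close>

lemma dense_part_glued_hom: "(\<lambda>x. (ltop B, {x})) \<in> res_lattice_hom D (dense_part glued)"
proof -
  have "ltop B \<curlyvee>\<^bsub>B\<^esub> ltop B = ltop B" "\<ominus> (ltop B) \<curlyvee>\<^bsub>B\<^esub> ltop B = ltop B"
    by (simp_all add: B.bcompl_top B.bot_join B.le_refl cl flip: B.le_iff_join)
  then show ?thesis
    unfolding res_lattice_hom_def dense_part_glued_carrier
    by (auto simp: dense_part_def glued_ops B.bcompl_top B.meet_idem proj_top proj_bot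
        D.meet_rtop cl)
qed

text \<open>The defining inequality says that the projection of \<open>x\<close> to
  \<open>\<ominus> a\<close> is the unit, so \<open>x\<close> lies in its kernel, which is
  \<open>\<phi> a\<close> after double complementation.\<close>

lemma phi_of_glued:
  assumes a: "a \<in> carrier B"
  shows "phi_of glued (a, {rtop D}) = (\<lambda>x. (ltop B, {x})) ` \<phi> a"
proof -
  have "\<sim>\<^bsub>glued\<^esub> (a, {rtop D}) \<preceq>\<^bsub>glued\<^esub> (ltop B, {x}) \<longleftrightarrow> x \<in> \<phi> a" if "x \<in> carrier D" for x
    using that a proj_eq_rtop_iff[of "\<ominus> a" x]
    by (simp add: glued_neg glued_le_iff glued_carrier_pair glued_le_pair rtop_in_phi phi_top
        B.ltop_greatest D.rtop_le_iff B.bcompl_bcompl cl)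
  then show ?thesis
    using a phi_carrier by (auto simp: phi_of_def dense_part_glued_carrier)
qed

lemma triple_iso_glued:
  "triple_iso (boolean_part glued, dense_part glued, phi_of glued) (B, D, \<phi>)"
proof (rule triple_iso_image[where h = "\<lambda>a. (a, {rtop D})" and k = "\<lambda>x. (ltop B, {x})"])
  show "triple_obj (B, D, \<phi>)"
    using B.alg_boolean_axioms D.residuated_lattice_axioms phi_hom by simp
qed (simp_all add: boolean_part_glued_hom boolean_part_glued_carrier dense_part_glued_hom
    dense_part_glued_carrier phi_of_glued inj_on_def)

end

theorem theorem3p12:
  fixes B :: "'b boolean_alg" and D :: "'d res_lattice" and \<phi> :: "'b \<Rightarrow> 'd set"
  assumes "triple_obj (B, D, \<phi>)"
  shows "\<exists>A :: ('b \<times> 'd set) bdd_res_lattice.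
           stonean_residuated_lattice A \<and>
           triple_iso (boolean_part A, dense_part A, phi_of A) (B, D, \<phi>)"
proof -
  interpret lattice_triple B D \<phi>
    using assms by (simp add: lattice_triple_def lattice_triple_axioms_def)
  show ?thesis
    using glued_stonean triple_iso_glued by blast
qed

end
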